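(* Let $\mathcal{M}_k$ denote the set of all $k$-uniform maximal left-compressed intersecting families on $[2k]$. For each integer $k \geq 2$ we have \[ 2^{\frac{1}{2}\binom{k-1}{\lfloor k/2\rfloor}} \leq |\mathcal{M}_k| \leq 2^{\frac{1}{2}\binom{2k}{k}}. \] Moreover, for all sufficiently large $k$ we have \[ 2^{\frac{1}{9}k^{-3/2}\binom{2k}{k}} < |\mathcal{M}_k| < 2^{7\log_2(k)\,k^{-3/2}\binom{2k}{k}}. \]
   Context: For sets $G=\{y_1<\dots<y_k\}$ and $F=\{x_1<\dots<x_k\}$ in $\binom{[n]}{k}$, $G$ is a left-compression of $F$, written $G \leq_{\mathrm{LC}} F$, if $y_i \leq x_i$ for every $i\in[k]$. A family $\mathcal{F}\subseteq\binom{[n]}{k}$ is left-compressed if whenever $F\in\mathcal{F}$ and $F'\in\binom{[n]}{k}$ with $F'\leq_{\mathrm{LC}} F$, we have $F'\in\mathcal{F}$. A family is intersecting if any two of its members intersect. A $k$-uniform maximal left-compressed intersecting family (MLCIF) on $[n]$ is a family $\mathcal{F}\subseteq\binom{[n]}{k}$ that is left-compressed and intersecting, and is maximal with respect to inclusion among left-compressed intersecting subfamilies of $\binom{[n]}{k}$. *)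

theory Defs
  imports Complex_Main "HOL-Library.Ramsey"
begin

text \<open>
  The ground set $[n]$ is \<^term>\<open>{1..n} :: nat set\<close>, and \<^term>\<open>nsets {1..n} k\<close> is the set of
  its $k$-element subsets.
\<close>

text \<open>
  The list \<^term>\<open>sorted_list_of_set F\<close> enumerates a finite set in increasing order, starting at
  index 0, so the index \<open>i\<close> below corresponds to $i + 1$ in the usual
  $F = \{x_1 < \dots < x_k\}$. The relation is only meant for finite sets.
\<close>

definition left_compression :: "nat set \<Rightarrow> nat set \<Rightarrow> bool" (infix "\<le>LC" 50) where
  "G \<le>LC F \<longleftrightarrow>
     card G = card F \<and>
     (\<forall>i<card F. sorted_list_of_set G ! i \<le> sorted_list_of_set F ! i)"

definition left_compressed :: "nat \<Rightarrow> nat \<Rightarrow> nat set set \<Rightarrow> bool" where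
  "left_compressed n k \<F> \<longleftrightarrow>
     (\<forall>F\<in>\<F>. \<forall>F'\<in>nsets {1..n} k. F' \<le>LC F \<longrightarrow> F' \<in> \<F>)"

definition intersecting :: "'a set set \<Rightarrow> bool" where
  "intersecting \<F> \<longleftrightarrow> (\<forall>F\<in>\<F>. \<forall>G\<in>\<F>. F \<inter> G \<noteq> {})"

definition left_compressed_intersecting :: "nat \<Rightarrow> nat \<Rightarrow> nat set set \<Rightarrow> bool" where
  "left_compressed_intersecting n k \<F> \<longleftrightarrow>
     \<F> \<subseteq> nsets {1..n} k \<and> left_compressed n k \<F> \<and> intersecting \<F>"

definition MLCIF :: "nat \<Rightarrow> nat \<Rightarrow> nat set set \<Rightarrow> bool" where
  "MLCIF n k \<F> \<longleftrightarrow>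
     left_compressed_intersecting n k \<F> \<and>
     (\<forall>\<G>. left_compressed_intersecting n k \<G> \<longrightarrow> \<F> \<subseteq> \<G> \<longrightarrow> \<G> = \<F>)"

definition MLCIFs :: "nat \<Rightarrow> nat set set set" where
  "MLCIFs k = {\<F>. MLCIF (2 * k) k \<F>}"

lemma finite_MLCIFs: "finite (MLCIFs k)"
proof (rule finite_subset)
  show "MLCIFs k \<subseteq> Pow (nsets {1..2 * k} k)"
    by (auto simp: MLCIFs_def MLCIF_def left_compressed_intersecting_def)
  show "finite (Pow (nsets {1..2 * k} k))"
    by (simp add: finite_imp_finite_nsets)
qed

end

theory Submission
  imports Defs "HOL-Analysis.Convex" "HOL-Real_Asymp.Real_Asymp"
begin

text \<open>
  Two \<open>k\<close>-subsets of \<open>[2k]\<close> are disjoint iff they are complementary, and complementation reverses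
  the compression order. Hence a maximal family is a down-set containing exactly one set of each
  complementary pair, which gives the upper bound \<open>2 ^ (N / 2)\<close> for \<open>N = (2k choose k)\<close>.

  For the lower bounds, a set avoiding \<open>1\<close> and \<open>2k\<close> is incomparable to every set containing both. So
  for an antichain of \<open>k\<close>-subsets of \<open>{2..2k-1}\<close> one may choose freely from each member and its
  complement. Sets of equal sum form an antichain, and Chebyshev's inequality provides a sum
  attained by \<open>\<Omega>(k\<^bsup>-3/2\<^esup> N)\<close> sets.

  For the asymptotic upper bound, a family is determined by the antichain of its maximal members. A
  commutator argument in the style of \<open>sl\<^sub>2\<close> representations shows that upper shadows below the middle
  sum do not shrink, so no antichain is larger than the middle level. The size of that level is
  bounded by Stein's method with the same weights: the total weight of the ways of
  lowering its members equals half the mean absolute deviation of the (centred, doubled) sum, at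
  most \<open>O(k\<^bsup>3/2\<^esup> N)\<close>, while all but exponentially few sets can be lowered with total weight
  \<open>\<Omega>(k\<^sup>3)\<close>.
\<close>

section \<open>The compression order and complementary pairs\<close>

lemma nsets_iff: "finite A \<Longrightarrow> F \<in> nsets A k \<longleftrightarrow> F \<subseteq> A \<and> card F = k"
  by (auto simp: nsets_def intro: finite_subset)

text \<open>Translates positions into counts: the indices whose entry is at most \<open>i\<close>
  form an initial segment of length \<open>card (F \<inter> {..i})\<close>.\<close>

lemma nth_sorted_list_of_set_le_iff:
  assumes "finite F" "j < card F"
  shows "sorted_list_of_set F ! j \<le> (i::nat) \<longleftrightarrow> j < card (F \<inter> {..i})"
proof -
  define xs where "xs = sorted_list_of_set F"
  have xs: "set xs = F" "length xs = card F" "strict_sorted xs" "distinct xs"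
    using assms by (auto simp: xs_def)
  have mono: "xs ! a \<le> xs ! b \<longleftrightarrow> a \<le> b" if "a < card F" "b < card F" for a b
    using sorted_wrt_nth_less[OF xs(3)] that xs(2)
    by (metis linorder_not_le nat_less_le order_refl not_less_iff_gr_or_eq)
  have inj: "inj_on ((!) xs) {..<card F}"
    using xs by (intro inj_on_nth) auto
  have F: "F = (!) xs ` {..<card F}"
    using xs by (auto simp: in_set_conv_nth image_iff set_conv_nth)
  have "F \<inter> {..i} = (!) xs ` {a. a < card F \<and> xs ! a \<le> i}"
    using F by auto
  then have c: "card (F \<inter> {..i}) = card {a. a < card F \<and> xs ! a \<le> i}"
    by (metis (no_types, lifting) card_image inj inj_on_subset lessThan_iff mem_Collect_eq subsetI)
  show ?thesis
  proof (cases "xs ! j \<le> i")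
    case True
    have "xs ! a \<le> i" if "a \<le> j" for a
      using mono[of a j] True that assms by simp
    then have "{..j} \<subseteq> {a. a < card F \<and> xs ! a \<le> i}"
      using assms by auto
    then have "card {..j} \<le> card {a. a < card F \<and> xs ! a \<le> i}"
      by (intro card_mono) auto
    then show ?thesis using True c by (simp add: xs_def)
  next
    case False
    have "a < j" if "a < card F" "xs ! a \<le> i" for a
      using mono[of j a] False that assms by (cases "a < j") auto
    then have "{a. a < card F \<and> xs ! a \<le> i} \<subseteq> {..<j}" by auto
    then have "card {a. a < card F \<and> xs ! a \<le> i} \<le> card {..<j}"
      by (intro card_mono) auto
    then show ?thesis using False c by (simp add: xs_def)
  qed
qed

text \<open>The counting form of the order. Unlike sorted lists, the counts of initial parts change
  transparently under complementation and under a swap of neighbours.\<close>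

lemma left_compression_iff:
  assumes "finite F" "finite G" "card F = card G"
  shows "F \<le>LC G \<longleftrightarrow> (\<forall>i. card (G \<inter> {..i}) \<le> card (F \<inter> {..i}))"
proof
  assume le: "F \<le>LC G"
  show "\<forall>i. card (G \<inter> {..i}) \<le> card (F \<inter> {..i})"
  proof (rule allI, rule ccontr)
    fix i assume "\<not> card (G \<inter> {..i}) \<le> card (F \<inter> {..i})"
    then have j: "card (F \<inter> {..i}) < card (G \<inter> {..i})" by simp
    moreover have "card (G \<inter> {..i}) \<le> card G" using assms by (intro card_mono) auto
    ultimately have jG: "card (F \<inter> {..i}) < card G" by simp
    then have "sorted_list_of_set G ! card (F \<inter> {..i}) \<le> i"
      using j nth_sorted_list_of_set_le_iff assms by simp
    then have "sorted_list_of_set F ! card (F \<inter> {..i}) \<le> i"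
      using le jG unfolding left_compression_def by (meson order_trans)
    then show False
      using nth_sorted_list_of_set_le_iff[of F] assms jG by simp
  qed
next
  assume c: "\<forall>i. card (G \<inter> {..i}) \<le> card (F \<inter> {..i})"
  show "F \<le>LC G"
    unfolding left_compression_def
  proof (intro conjI allI impI)
    fix j assume j: "j < card G"
    have "j < card (G \<inter> {..sorted_list_of_set G ! j})"
      using nth_sorted_list_of_set_le_iff[of G j] assms j by blast
    then show "sorted_list_of_set F ! j \<le> sorted_list_of_set G ! j"
      using nth_sorted_list_of_set_le_iff[of F j] assms j c
      by (metis order_less_le_trans)
  qed (use assms in simp)
qed

lemma left_compression_refl [simp]: "F \<le>LC F"
  by (simp add: left_compression_def)

lemma left_compression_trans: "F \<le>LC G \<Longrightarrow> G \<le>LC H \<Longrightarrow> F \<le>LC H"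
  by (auto simp: left_compression_def intro: order_trans)

lemma sum_eq_sum_nth_sorted_list_of_set:
  assumes "finite F"
  shows "\<Sum>F = (\<Sum>i<card F. sorted_list_of_set F ! i)"
proof -
  have "\<Sum>F = sum_list (sorted_list_of_set F)"
    using assms sum_list_distinct_conv_sum_set[of "sorted_list_of_set F" "\<lambda>x. x"] by simp
  then show ?thesis by (simp add: sum_list_sum_nth atLeast0LessThan)
qed

lemma left_compression_sum_le:
  assumes "finite F" "finite G" "F \<le>LC G"
  shows "\<Sum>F \<le> \<Sum>G"
  using assms by (auto simp: sum_eq_sum_nth_sorted_list_of_set left_compression_def intro!: sum_mono)

text \<open>Termwise inequalities with equal totals are equalities. So the sum is strictly monotone
  for \<open>\<le>LC\<close> on finite sets and acts as a rank function throughout.\<close>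

lemma left_compression_sum_eq:
  assumes "finite F" "finite G" "F \<le>LC G" "\<Sum>F = \<Sum>G"
  shows "F = G"
proof -
  have card: "card F = card G" and le: "\<And>i. i < card G \<Longrightarrow> sorted_list_of_set F ! i \<le> sorted_list_of_set G ! i"
    using assms by (auto simp: left_compression_def)
  have "sorted_list_of_set F ! i = sorted_list_of_set G ! i" if "i < card G" for i
    using sum_mono_inv[of "\<lambda>i. sorted_list_of_set F ! i" "{..<card G}" "\<lambda>i. sorted_list_of_set G ! i" i]
      that le assms card by (simp add: sum_eq_sum_nth_sorted_list_of_set)
  then have "sorted_list_of_set F = sorted_list_of_set G"
    using card by (intro nth_equalityI) auto
  then show ?thesis using assms by (metis set_sorted_list_of_set)
qed

text \<open>With \<open>0 \<notin> F\<close>, the count of \<open>F\<close> up to \<open>1\<close>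
  only records whether \<open>1\<close> is a member. This and the dual fact on the largest element
  give the incomparabilities behind the lower bounds.\<close>

lemma left_compression_one_mem:
  assumes "finite F" "finite G" "F \<le>LC G" "1 \<in> G" "0 \<notin> F"
  shows "1 \<in> F"
proof -
  have "card F = card G" using assms by (simp add: left_compression_def)
  then have "card (G \<inter> {..1}) \<le> card (F \<inter> {..1})"
    using assms left_compression_iff by blast
  moreover have "0 < card (G \<inter> {..1})" using assms by (auto simp: card_gt_0_iff)
  ultimately have "F \<inter> {..1} \<noteq> {}" by auto
  then obtain x where "x \<in> F" "x \<le> 1" by auto
  then show ?thesis using assms(5) by (cases x) auto
qed

text \<open>If \<open>G\<close> missed the top element, its count up to \<open>n\<close> would be
  full; the count of \<open>F\<close> is at least as large, but \<open>Suc n \<in> F\<close> keeps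
  it from being full.\<close>

lemma left_compression_top_mem:
  assumes "finite F" "finite G" "F \<le>LC G" "Suc n \<in> F" "G \<subseteq> {..Suc n}"
  shows "Suc n \<in> G"
proof (rule ccontr)
  assume *: "Suc n \<notin> G"
  have c: "card F = card G" using assms by (simp add: left_compression_def)
  then have "card (G \<inter> {..n}) \<le> card (F \<inter> {..n})"
    using assms left_compression_iff by blast
  moreover have "G \<inter> {..n} = G" using assms(5) * by (auto simp: le_Suc_eq)
  moreover have "card (F \<inter> {..n}) < card F" using assms
    by (metis Int_iff Suc_n_not_le_n atMost_iff inf_le1 psubset_card_mono psubsetI)
  ultimately show False using c by simp
qed

definition LC_antichain :: "nat set set \<Rightarrow> bool" where
  "LC_antichain \<A> \<longleftrightarrow> (\<forall>F\<in>\<A>. \<forall>G\<in>\<A>. F \<le>LC G \<longrightarrow> F = G)"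

section \<open>Complementation in \<open>[2k]\<close>\<close>

lemma card_complement:
  assumes "F \<in> nsets {1..2 * k} k"
  shows "{1..2 * k} - F \<in> nsets {1..2 * k} k"
proof -
  have "finite F" "F \<subseteq> {1..2 * k}" "card F = k" using assms by (auto simp: nsets_def)
  then show ?thesis by (simp add: nsets_iff card_Diff_subset)
qed

lemma sum_complement:
  assumes "F \<subseteq> {1..2 * k::nat}"
  shows "\<Sum>({1..2 * k} - F) + \<Sum>F = k * (2 * k + 1)"
proof -
  have "\<Sum>({1..2 * k} - F) + \<Sum>F = \<Sum>{1..2 * k}"
    using sum.subset_diff[OF assms, of "\<lambda>x. x"] by simp
  also have "\<dots> = k * (2 * k + 1)"
    using Sum_Icc_nat[of 1 "2 * k"] by simp
  finally show ?thesis .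
qed

text \<open>Within \<open>{1..min i (2 * k)}\<close> the counts of a set and of its complement add
  up to a constant, so comparisons of counts reverse.\<close>

lemma left_compression_complement:
  assumes F: "F \<in> nsets {1..2 * k} k" and G: "G \<in> nsets {1..2 * k} k" and "F \<le>LC G"
  shows "{1..2 * k} - G \<le>LC {1..2 * k} - F"
proof -
  have *: "card (({1..2 * k} - H) \<inter> {..i}) = min i (2 * k) - card (H \<inter> {..i})"
    and le: "card (H \<inter> {..i}) \<le> min i (2 * k)"
    if "H \<in> nsets {1..2 * k} k" for H i
  proof -
    have H: "H \<inter> {..i} \<subseteq> {1..min i (2 * k)}" using that by (auto simp: nsets_iff)
    have "({1..2 * k} - H) \<inter> {..i} = {1..min i (2 * k)} - (H \<inter> {..i})" by auto
    then show "card (({1..2 * k} - H) \<inter> {..i}) = min i (2 * k) - card (H \<inter> {..i})"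
      using H by (simp add: card_Diff_subset finite_subset[OF H])
    show "card (H \<inter> {..i}) \<le> min i (2 * k)"
      using card_mono[OF _ H] by simp
  qed
  have "card (G \<inter> {..i}) \<le> card (F \<inter> {..i})" for i
    using left_compression_iff[of F G] assms by (auto simp: nsets_def)
  then have "card (({1..2 * k} - F) \<inter> {..i}) \<le> card (({1..2 * k} - G) \<inter> {..i})" for i
    using *[OF F, of i] *[OF G, of i] le[OF F, of i] le[OF G, of i] by (simp add: diff_le_mono2)
  then show ?thesis
    using card_complement[OF F] card_complement[OF G]
    by (subst left_compression_iff) (auto simp: nsets_iff)
qed

lemma disjoint_iff_complement:
  assumes "F \<in> nsets {1..2 * k} k" "G \<in> nsets {1..2 * k} k"
  shows "F \<inter> G = {} \<longleftrightarrow> G = {1..2 * k} - F"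
proof
  assume "F \<inter> G = {}"
  then have "G \<subseteq> {1..2 * k} - F" using assms by (auto simp: nsets_iff)
  then show "G = {1..2 * k} - F"
    using card_complement[OF assms(1)] assms(2) by (metis card_subset_eq finite_Diff finite_atLeastAtMost nsets_iff)
qed auto

text \<open>Turns a condition on pairs into one on single members: the only disjoint partner of a
  set is its complement.\<close>

lemma left_compressed_intersecting_iff:
  "left_compressed_intersecting (2 * k) k \<D> \<longleftrightarrow>
     \<D> \<subseteq> nsets {1..2 * k} k \<and> left_compressed (2 * k) k \<D> \<and> (\<forall>F\<in>\<D>. {1..2 * k} - F \<notin> \<D>)"
proof (cases "\<D> \<subseteq> nsets {1..2 * k} k")
  case True
  have "F \<inter> G = {} \<longleftrightarrow> G = {1..2 * k} - F" if "F \<in> \<D>" "G \<in> \<D>" for F G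
    using True that disjoint_iff_complement by blast
  then have "intersecting \<D> \<longleftrightarrow> (\<forall>F\<in>\<D>. {1..2 * k} - F \<notin> \<D>)"
    unfolding intersecting_def by blast
  then show ?thesis by (simp add: left_compressed_intersecting_def)
qed (simp add: left_compressed_intersecting_def)

text \<open>A left-compressed intersecting family missing both sets of some complementary pair can be
  enlarged: among the missing pairs, a set of least sum lies above members of the family only.\<close>

lemma MLCIF_complement_iff:
  assumes "MLCIF (2 * k) k \<D>" "F \<in> nsets {1..2 * k} k" "k > 0"
  shows "{1..2 * k} - F \<in> \<D> \<longleftrightarrow> F \<notin> \<D>"
proof -
  have lci: "left_compressed_intersecting (2 * k) k \<D>" using assms by (simp add: MLCIF_def)
  note D = lci[unfolded left_compressed_intersecting_iff]
  show ?thesis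
  proof
    assume "{1..2 * k} - F \<in> \<D>"
    then show "F \<notin> \<D>" using D by blast
  next
    assume F: "F \<notin> \<D>"
    show "{1..2 * k} - F \<in> \<D>"
    proof (rule ccontr)
      assume cF: "{1..2 * k} - F \<notin> \<D>"
      define U where "U G \<longleftrightarrow> G \<in> nsets {1..2 * k} k \<and> G \<notin> \<D> \<and> {1..2 * k} - G \<notin> \<D>" for G
      have "\<exists>G. U G" using F cF assms(2) by (auto simp: U_def)
      then obtain G where G: "U G" and min: "\<And>H. U H \<Longrightarrow> \<Sum>G \<le> \<Sum>H"
        using ex_has_least_nat[of U _ "\<lambda>G. \<Sum>G"] by blast
      have GP: "G \<in> nsets {1..2 * k} k" using G by (simp add: U_def)
      \<comment> \<open>A set strictly below \<open>G\<close> has smaller sum, so by minimality its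
        pair meets the family. If the complement of \<open>H\<close> were the member, the complement
        of \<open>G\<close>, which lies below it, would be one too.\<close>
      have below: "H \<in> \<D>" if H: "H \<in> nsets {1..2 * k} k" "H \<le>LC G" "H \<noteq> G" for H
      proof (rule ccontr)
        assume nH: "H \<notin> \<D>"
        have fin: "finite G" "finite H" using GP H by (auto simp: nsets_def)
        have "\<Sum>H < \<Sum>G"
          using left_compression_sum_le left_compression_sum_eq fin H by (metis le_neq_implies_less)
        then have "{1..2 * k} - H \<in> \<D>" using min[of H] nH H by (auto simp: U_def)
        moreover have "{1..2 * k} - G \<le>LC {1..2 * k} - H"
          using left_compression_complement H GP by blast
        ultimately have "{1..2 * k} - G \<in> \<D>"
          using D card_complement[OF GP] by (auto simp: left_compressed_def)
        then show False using G by (simp add: U_def)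
      qed
      have double: "{1..2 * k} - ({1..2 * k} - H) = H" if "H \<in> nsets {1..2 * k} k" for H
        using that by (auto simp: nsets_iff)
      \<comment> \<open>Here \<open>k > 0\<close> enters: a set equal to its complement is empty,
        and so is the ground set. Adding \<open>G\<close> thus does not add its complement.\<close>
      have GcG: "{1..2 * k} - G \<noteq> G"
      proof
        assume *: "{1..2 * k} - G = G"
        then have "G = {}" by blast
        with * assms(3) show False by simp
      qed
      have "left_compressed_intersecting (2 * k) k (insert G \<D>)"
        unfolding left_compressed_intersecting_iff
      proof (intro conjI)
        show "insert G \<D> \<subseteq> nsets {1..2 * k} k" using D GP by simp
        show "left_compressed (2 * k) k (insert G \<D>)"
          using D below by (auto simp: left_compressed_def)
        show "\<forall>F\<in>insert G \<D>. {1..2 * k} - F \<notin> insert G \<D>"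
          using D G GcG double by (auto simp: U_def)
      qed
      then have "insert G \<D> = \<D>" using assms(1) by (auto simp: MLCIF_def)
      then show False using G by (auto simp: U_def)
    qed
  qed
qed

section \<open>Extension to maximal families and the first upper bound\<close>

lemma left_compressed_intersecting_extend:
  assumes "left_compressed_intersecting (2 * k) k \<D>"
  shows "\<exists>\<M>. MLCIF (2 * k) k \<M> \<and> \<D> \<subseteq> \<M>"
proof -
  define S where "S = {\<E>. left_compressed_intersecting (2 * k) k \<E>}"
  have "finite S"
    by (rule finite_subset[of _ "Pow (nsets {1..2 * k} k)"])
      (auto simp: S_def left_compressed_intersecting_def finite_imp_finite_nsets)
  moreover have "\<D> \<in> S" using assms by (simp add: S_def)
  ultimately obtain \<M> where "\<M> \<in> S" "\<D> \<subseteq> \<M>" "\<And>\<E>. \<E> \<in> S \<Longrightarrow> \<M> \<subseteq> \<E> \<Longrightarrow> \<E> = \<M>"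
    using finite_has_maximal2[of S \<D>] by metis
  then show ?thesis by (auto simp: S_def MLCIF_def)
qed

text \<open>By \<open>MLCIF_complement_iff\<close> a family is determined by its members containing
  \<open>1\<close>, and exactly one set of each complementary pair contains
  \<open>1\<close>.\<close>

lemma card_MLCIFs_le:
  assumes "k > 0"
  shows "card (MLCIFs k) \<le> 2 ^ ((2 * k - 1) choose (k - 1))"
proof -
  define Q where "Q = {F \<in> nsets {1..2 * k} k. 1 \<in> F}"
  have Q: "Q = insert 1 ` nsets {2..2 * k} (k - 1)"
  proof (intro equalityI subsetI)
    fix F assume "F \<in> Q"
    then have F: "F \<subseteq> {1..2 * k}" "card F = k" "1 \<in> F" "finite F"
      by (auto simp: Q_def nsets_def)
    have "x \<ge> 2" if "x \<in> F - {1}" for x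
      using F that by (cases "x = 0") fastforce+
    then have "F - {1} \<in> nsets {2..2 * k} (k - 1)" "insert 1 (F - {1}) = F"
      using F by (auto simp: nsets_def subset_iff)
    then show "F \<in> insert 1 ` nsets {2..2 * k} (k - 1)" by (metis imageI)
  next
    fix F assume "F \<in> insert 1 ` nsets {2..2 * k} (k - 1)"
    then obtain G where G: "G \<subseteq> {2..2 * k}" "finite G" "card G = k - 1" "F = insert 1 G"
      by (auto simp: nsets_def)
    then have "1 \<notin> G" by auto
    then show "F \<in> Q" using G assms by (auto simp: Q_def nsets_def)
  qed
  have "inj_on (insert 1) (nsets {2..2 * k} (k - 1))"
    by (rule inj_onI) (auto simp: nsets_def dest!: insert_ident[THEN iffD1, rotated 2])
  then have "card Q = card (nsets {2..2 * k} (k - 1))" by (simp add: Q card_image)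
  also have "\<dots> = (2 * k - 1) choose (k - 1)"
    by (simp add: card_nsets)
  finally have cQ: "card Q = (2 * k - 1) choose (k - 1)" .
  have finQ: "finite Q"
    by (simp add: Q_def finite_imp_finite_nsets)
  have "inj_on (\<lambda>\<D>. \<D> \<inter> Q) (MLCIFs k)"
  proof (rule inj_onI)
    fix \<D> \<E> assume D: "\<D> \<in> MLCIFs k" and E: "\<E> \<in> MLCIFs k" and eq: "\<D> \<inter> Q = \<E> \<inter> Q"
    have sub: "\<D> \<subseteq> nsets {1..2 * k} k" "\<E> \<subseteq> nsets {1..2 * k} k"
      using D E by (auto simp: MLCIFs_def MLCIF_def left_compressed_intersecting_def)
    have "F \<in> \<D> \<longleftrightarrow> F \<in> \<E>" if F: "F \<in> nsets {1..2 * k} k" for F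
    proof (cases "1 \<in> F")
      case True
      then have "F \<in> Q" using F by (simp add: Q_def)
      then show ?thesis using eq by blast
    next
      case False
      then have "{1..2 * k} - F \<in> Q" using card_complement[OF F] assms by (simp add: Q_def)
      then have "{1..2 * k} - F \<in> \<D> \<longleftrightarrow> {1..2 * k} - F \<in> \<E>" using eq by blast
      then show ?thesis
        using MLCIF_complement_iff[OF _ F assms] D E by (auto simp: MLCIFs_def)
    qed
    then show "\<D> = \<E>" using sub by blast
  qed
  then have "card (MLCIFs k) \<le> card (Pow Q)"
    using finQ by (intro card_inj_on_le) auto
  then show ?thesis using finQ cQ by (simp add: card_Pow)
qed

section \<open>Families from antichains\<close>

lemma LC_antichain_sum_level:
  assumes "\<And>F. F \<in> \<A> \<Longrightarrow> finite F \<and> \<Sum>F = s"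
  shows "LC_antichain \<A>"
  using assms left_compression_sum_eq unfolding LC_antichain_def by metis

text \<open>Every subset \<open>T\<close> of the antichain prescribes a choice between each member
  and its complement. The choice extends to a maximal family, from which \<open>T\<close> can be
  read off.\<close>

lemma two_power_card_antichain_le:
  assumes B: "\<B> \<subseteq> nsets {2..2 * k - 1} k" and anti: "LC_antichain \<B>" and k: "k > 0"
  shows "2 ^ card \<B> \<le> card (MLCIFs k)"
proof -
  let ?c = "\<lambda>F. {1..2 * k} - F"
  have BP: "F \<in> nsets {1..2 * k} k" if "F \<in> \<B>" for F
    using B that by (fastforce simp: nsets_def)
  have n1: "1 \<notin> F" "2 * k \<notin> F" if "F \<in> \<B>" for F
    using B that k by (fastforce simp: nsets_def)+
  have double: "?c (?c F) = F" if "F \<in> nsets {1..2 * k} k" for F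
    using that by (auto simp: nsets_def)
  have fin: "finite F" "0 \<notin> F" "F \<subseteq> {..2 * k}" if "F \<in> nsets {1..2 * k} k" for F
    using that by (auto simp: nsets_def)
  have "\<exists>\<M>. \<M> \<in> MLCIFs k \<and> T \<subseteq> \<M> \<and> ?c ` (\<B> - T) \<subseteq> \<M>" if T: "T \<subseteq> \<B>" for T
  proof -
    \<comment> \<open>The generators are the chosen sets: members of \<open>T\<close>, and
      complements of the members left out.\<close>
    define gens where "gens = T \<union> ?c ` (\<B> - T)"
    define \<D> where "\<D> = {F \<in> nsets {1..2 * k} k. \<exists>G\<in>gens. F \<le>LC G}"
    have gP: "G \<in> nsets {1..2 * k} k" if "G \<in> gens" for G
      using that T BP card_complement by (auto simp: gens_def)
    \<comment> \<open>The complement of \<open>b\<close> contains \<open>2 * k\<close>, which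
      \<open>a\<close> misses; dually, in \<open>above\<close>, the complement of \<open>a\<close>
      contains \<open>1\<close>, which \<open>b\<close> misses.\<close>
    have below: "\<not> ?c b \<le>LC a" if "a \<in> \<B>" "b \<in> \<B>" for a b
    proof
      assume le: "?c b \<le>LC a"
      obtain m where m: "2 * k = Suc m" using k by (cases "2 * k") auto
      have "2 * k \<in> a"
        using left_compression_top_mem[of "?c b" a m] le fin[OF BP[OF that(1)]] n1[OF that(2)] m
        by (simp add: k)
      then show False using n1 that by blast
    qed
    have above: "\<not> b \<le>LC ?c a" if "a \<in> \<B>" "b \<in> \<B>" for a b
    proof
      assume le: "b \<le>LC ?c a"
      have "1 \<in> b"
        using left_compression_one_mem[of b "?c a"] le fin[OF BP[OF that(2)]] n1[OF that(1)] k
        by simp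
      then show False using n1 that by blast
    qed
    \<comment> \<open>This is what intersection of the generated down-set reduces to. Generators of
      the same kind are handled by \<open>below\<close> and \<open>above\<close>, those of different
      kinds by the antichain property.\<close>
    have no: "\<not> ?c g' \<le>LC g" if g: "g \<in> gens" "g' \<in> gens" for g g'
    proof
      assume le: "?c g' \<le>LC g"
      show False
      proof (cases "g \<in> T")
        case gT: True
        show False
        proof (cases "g' \<in> T")
          case True
          then show False using gT T below le by blast
        next
          case False
          then obtain b where b: "b \<in> \<B>" "b \<notin> T" "g' = ?c b" using g by (auto simp: gens_def)
          then have "b \<le>LC g" using le double BP by simp
          then show False using b gT T anti by (auto simp: LC_antichain_def)
        qed
      next
        case False
        then obtain b where b: "b \<in> \<B>" "b \<notin> T" "g = ?c b" using g by (auto simp: gens_def)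
        show False
        proof (cases "g' \<in> T")
          case True
          then have "?c (?c b) \<le>LC ?c (?c g')"
            using le b left_compression_complement card_complement BP T by blast
          then have "b \<le>LC g'" using double BP b True T by (metis subsetD)
          then show False using b True T anti by (auto simp: LC_antichain_def)
        next
          case False
          then obtain b' where b': "b' \<in> \<B>" "b' \<notin> T" "g' = ?c b'" using g by (auto simp: gens_def)
          then have "b' \<le>LC ?c b" using le b double BP by simp
          then show False using above b b' by blast
        qed
      qed
    qed
    have "left_compressed_intersecting (2 * k) k \<D>"
      unfolding left_compressed_intersecting_iff
    proof (intro conjI ballI)
      show "left_compressed (2 * k) k \<D>"
        by (auto simp: left_compressed_def \<D>_def intro: left_compression_trans)
    next
      fix F assume "F \<in> \<D>"
      then obtain g where F: "F \<in> nsets {1..2 * k} k" and g: "g \<in> gens" "F \<le>LC g"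
        by (auto simp: \<D>_def)
      show "?c F \<notin> \<D>"
      proof
        assume "?c F \<in> \<D>"
        then obtain g' where g': "g' \<in> gens" "?c F \<le>LC g'"
          by (auto simp: \<D>_def)
        \<comment> \<open>If \<open>F\<close> lies below \<open>g\<close> and its complement below
          \<open>g'\<close>, reversal places the complement of \<open>g'\<close> below
          \<open>F\<close>, hence below \<open>g\<close>.\<close>
        then have "?c g' \<le>LC ?c (?c F)"
          using left_compression_complement card_complement F gP by blast
        then have "?c g' \<le>LC g" using double[OF F] g left_compression_trans by metis
        then show False using no g g' by blast
      qed
    qed (auto simp: \<D>_def)
    then obtain \<M> where "MLCIF (2 * k) k \<M>" "\<D> \<subseteq> \<M>"
      using left_compressed_intersecting_extend by blast
    moreover have "gens \<subseteq> \<D>" using gP left_compression_refl unfolding \<D>_def by blast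
    ultimately have "\<M> \<in> MLCIFs k" "gens \<subseteq> \<M>" by (auto simp: MLCIFs_def)
    then show ?thesis unfolding gens_def by (intro exI[of _ \<M>]) simp
  qed
  then obtain M where M: "\<And>T. T \<subseteq> \<B> \<Longrightarrow> M T \<in> MLCIFs k" "\<And>T. T \<subseteq> \<B> \<Longrightarrow> T \<subseteq> M T"
    "\<And>T. T \<subseteq> \<B> \<Longrightarrow> ?c ` (\<B> - T) \<subseteq> M T"
    by metis
  \<comment> \<open>For \<open>b\<close> outside \<open>T\<close> the family contains the complement
    of \<open>b\<close>, hence not \<open>b\<close> itself.\<close>
  have rec: "T = M T \<inter> \<B>" if T: "T \<subseteq> \<B>" for T
  proof -
    have "b \<notin> M T" if "b \<in> \<B> - T" for b
      using MLCIF_complement_iff[of k "M T" b] M[OF T] that BP k by (auto simp: MLCIFs_def)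
    then show ?thesis using M[OF T] T by blast
  qed
  have "inj_on M (Pow \<B>)"
    by (rule inj_onI) (metis rec PowD)
  moreover have "M ` Pow \<B> \<subseteq> MLCIFs k" using M by auto
  ultimately have "card (Pow \<B>) \<le> card (MLCIFs k)"
    using finite_MLCIFs by (intro card_inj_on_le)
  moreover have "finite \<B>"
    using B by (rule finite_subset) (simp add: finite_imp_finite_nsets)
  ultimately show ?thesis by (simp add: card_Pow)
qed

text \<open>Besides \<open>2\<close> and \<open>3\<close>, take one element of each pair
  \<open>{2 * i + 2, 2 * i + 3}\<close>, the larger one iff \<open>i \<in> S\<close>. The sum then
  depends only on \<open>card S\<close>, so all \<open>j\<close>-subsets \<open>S\<close> of
  \<open>{1..k - 2}\<close> land in one level.\<close>

lemma exists_sum_level_ge_choose: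
  assumes "k \<ge> 2"
  shows "\<exists>s. (k - 2) choose j \<le> card {F \<in> nsets {2..2 * k - 1} k. \<Sum>F = s}"
proof -
  define e where "e S i = 2 * i + 2 + (if i \<in> S then 1 else 0)" for S and i :: nat
  define \<phi> where "\<phi> S = {2, 3} \<union> e S ` {1..k - 2}" for S
  have inj_e: "inj_on (e S) {1..k - 2}" for S
  proof (rule inj_onI)
    fix x y assume "e S x = e S y"
    moreover have "x = e S x div 2 - 1" "y = e S y div 2 - 1" by (simp_all add: e_def)
    ultimately show "x = y" by simp
  qed
  have dis: "{2, 3} \<inter> e S ` {1..k - 2} = {}" for S
  proof -
    have "e S i \<ge> 4" if "i \<in> {1..k - 2}" for i using that by (simp add: e_def)
    then show ?thesis by fastforce
  qed
  have mem: "2 * i + 3 \<in> \<phi> S \<longleftrightarrow> i \<in> S" if i: "i \<in> {1..k - 2}" for S i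
  proof
    assume "2 * i + 3 \<in> \<phi> S"
    then obtain j where j: "2 * i + 3 = e S j" using i by (auto simp: \<phi>_def)
    moreover have "j = e S j div 2 - 1" by (simp add: e_def)
    ultimately have "j = i" by simp
    with j show "i \<in> S" by (cases "i \<in> S") (auto simp: e_def)
  next
    assume "i \<in> S"
    then have "2 * i + 3 = e S i" by (simp add: e_def)
    then show "2 * i + 3 \<in> \<phi> S" using i by (auto simp: \<phi>_def)
  qed
  have sub: "\<phi> S \<subseteq> {2..2 * k - 1}" for S
    using assms by (auto simp: \<phi>_def e_def)
  have card: "card (\<phi> S) = k" for S
    using assms card_image[OF inj_e, of S] dis[of S] by (simp add: \<phi>_def card_Un_disjoint)
  have sum: "\<Sum>(\<phi> S) = 5 + (\<Sum>i\<in>{1..k - 2}. 2 * i + 2) + j" if S: "S \<in> nsets {1..k - 2} j" for S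
  proof -
    have "\<Sum>(\<phi> S) = 5 + \<Sum>(e S ` {1..k - 2})"
      unfolding \<phi>_def using dis[of S] by (subst sum.union_disjoint) auto
    also have "\<Sum>(e S ` {1..k - 2}) = (\<Sum>i\<in>{1..k - 2}. e S i)"
      using inj_e[of S] by (simp add: sum.reindex)
    also have "\<dots> = (\<Sum>i\<in>{1..k - 2}. 2 * i + 2) + (\<Sum>i\<in>{1..k - 2}. if i \<in> S then 1 else 0)"
      unfolding e_def by (rule sum.distrib)
    also have "(\<Sum>i\<in>{1..k - 2}. if i \<in> S then 1 else 0) = card ({1..k - 2} \<inter> S)"
      by (simp add: sum.If_cases)
    also have "{1..k - 2} \<inter> S = S" using S by (auto simp: nsets_def)
    also have "card S = j" using S by (simp add: nsets_def)
    finally show ?thesis by simp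
  qed
  define s where "s = 5 + (\<Sum>i\<in>{1..k - 2}. 2 * i + 2) + j"
  have "inj_on \<phi> (nsets {1..k - 2} j)"
  proof (rule inj_onI)
    fix S T assume S: "S \<in> nsets {1..k - 2} j" "T \<in> nsets {1..k - 2} j" and "\<phi> S = \<phi> T"
    then have "i \<in> S \<longleftrightarrow> i \<in> T" if "i \<in> {1..k - 2}" for i using mem[OF that] by metis
    then show "S = T" using S by (auto simp: nsets_def)
  qed
  moreover have "\<phi> ` nsets {1..k - 2} j \<subseteq> {F \<in> nsets {2..2 * k - 1} k. \<Sum>F = s}"
    using sub card sum by (auto simp: s_def nsets_iff)
  ultimately have "card (nsets {1..k - 2} j) \<le> card {F \<in> nsets {2..2 * k - 1} k. \<Sum>F = s}"
    by (intro card_inj_on_le) (auto simp: finite_imp_finite_nsets)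
  then show ?thesis by (auto simp: card_nsets)
qed

lemma two_power_sum_level_le:
  assumes "k > 0"
  shows "2 ^ card {F \<in> nsets {2..2 * k - 1} k. \<Sum>F = s} \<le> card (MLCIFs k)"
proof (rule two_power_card_antichain_le)
  show "LC_antichain {F \<in> nsets {2..2 * k - 1} k. \<Sum>F = s}"
    by (rule LC_antichain_sum_level) (auto simp: nsets_def)
qed (use assms in auto)

lemma card_MLCIFs_bounds:
  assumes "k \<ge> 2"
  shows "2 powr (1 / 2 * real ((k - 1) choose (k div 2))) \<le> real (card (MLCIFs k))"
    and "real (card (MLCIFs k)) \<le> 2 powr (1 / 2 * real ((2 * k) choose k))"
proof -
  obtain s where s: "(k - 2) choose ((k - 2) div 2) \<le> card {F \<in> nsets {2..2 * k - 1} k. \<Sum>F = s}"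
    using exists_sum_level_ge_choose[OF assms] by blast
  obtain m where m: "k = Suc (Suc m)"
    using assms by (metis add_2_eq_Suc le_Suc_ex)
  \<comment> \<open>Pascal's rule gives two terms, each at most the central coefficient; the factor
    2 is absorbed by the \<open>1 / 2\<close> in the exponent.\<close>
  have "(k - 1) choose (k div 2) = (m choose (m div 2)) + (m choose Suc (m div 2))"
    by (simp add: m)
  also have "\<dots> \<le> 2 * (m choose (m div 2))"
    using binomial_maximum[of m "Suc (m div 2)"] by simp
  also have "\<dots> \<le> 2 * card {F \<in> nsets {2..2 * k - 1} k. \<Sum>F = s}"
    using s by (simp add: m)
  finally have "1 / 2 * real ((k - 1) choose (k div 2)) \<le> real (card {F \<in> nsets {2..2 * k - 1} k. \<Sum>F = s})"
    by linarith
  then have "2 powr (1 / 2 * real ((k - 1) choose (k div 2)))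
      \<le> 2 powr real (card {F \<in> nsets {2..2 * k - 1} k. \<Sum>F = s})"
    by (intro powr_mono) auto
  also have "\<dots> = real (2 ^ card {F \<in> nsets {2..2 * k - 1} k. \<Sum>F = s})"
    by (simp add: powr_realpow)
  also have "\<dots> \<le> real (card (MLCIFs k))"
    using two_power_sum_level_le[of k s] assms by (simp del: of_nat_power)
  finally show "2 powr (1 / 2 * real ((k - 1) choose (k div 2))) \<le> real (card (MLCIFs k))" .
next
  have "k * (2 * k choose k) = k * (2 * ((2 * k - 1) choose (k - 1)))"
    using times_binomial_minus1_eq[of k "2 * k"] assms by simp
  then have eq: "(2 * k) choose k = 2 * ((2 * k - 1) choose (k - 1))" using assms by simp
  have "real (card (MLCIFs k)) \<le> real (2 ^ ((2 * k - 1) choose (k - 1)))"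
    using card_MLCIFs_le[of k] assms by (simp del: of_nat_power)
  also have "\<dots> = 2 powr (1 / 2 * real ((2 * k) choose k))"
    by (simp add: eq powr_realpow)
  finally show "real (card (MLCIFs k)) \<le> 2 powr (1 / 2 * real ((2 * k) choose k))" .
qed

section \<open>The largest antichain\<close>

subsection \<open>Adjacent swaps\<close>

text \<open>Encoded as the full transposition of \<open>y\<close> and \<open>Suc y\<close>, so that
  it is an involution on all sets. Whether it raises or lowers a set is recorded separately by
  \<open>can_raise\<close> and \<open>can_lower\<close>.\<close>

definition swap_adj :: "nat \<Rightarrow> nat set \<Rightarrow> nat set" where
  "swap_adj y F = {x. if x = y then Suc y \<in> F else if x = Suc y then y \<in> F else x \<in> F}"

definition can_raise :: "nat \<Rightarrow> nat set \<Rightarrow> bool" where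
  "can_raise y F \<longleftrightarrow> y \<in> F \<and> Suc y \<notin> F"

definition can_lower :: "nat \<Rightarrow> nat set \<Rightarrow> bool" where
  "can_lower y F \<longleftrightarrow> y \<notin> F \<and> Suc y \<in> F"

lemma mem_swap_adj_iff:
  "x \<in> swap_adj y F \<longleftrightarrow> (if x = y then Suc y \<in> F else if x = Suc y then y \<in> F else x \<in> F)"
  by (simp add: swap_adj_def)

lemma swap_adj_swap_adj [simp]: "swap_adj y (swap_adj y F) = F"
  by (auto simp: set_eq_iff mem_swap_adj_iff)

lemma can_raise_swap_adj [simp]: "can_raise y (swap_adj y F) \<longleftrightarrow> can_lower y F"
  by (auto simp: can_raise_def can_lower_def mem_swap_adj_iff)

lemma can_lower_swap_adj [simp]: "can_lower y (swap_adj y F) \<longleftrightarrow> can_raise y F"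
  by (auto simp: can_raise_def can_lower_def mem_swap_adj_iff)

lemma swap_adj_eq_image:
  "swap_adj y F = (\<lambda>x. if x = y then Suc y else if x = Suc y then y else x) ` F"
  by (fastforce simp: image_iff mem_swap_adj_iff split: if_splits)

lemma card_swap_adj [simp]: "card (swap_adj y F) = card F"
  unfolding swap_adj_eq_image by (rule card_image) (auto simp: inj_on_def)

lemma swap_adj_nsets:
  assumes "F \<in> nsets {1..n} k" "y \<in> {1..<n}"
  shows "swap_adj y F \<in> nsets {1..n} k"
proof -
   have "swap_adj y F \<subseteq> {1..n}"
    using assms by (auto simp: swap_adj_eq_image nsets_def subset_iff)
  then show ?thesis using assms by (simp add: nsets_iff)
qed

lemma swap_adj_eq_insert: "can_raise y F \<Longrightarrow> swap_adj y F = insert (Suc y) (F - {y})"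
  by (auto simp: can_raise_def set_eq_iff mem_swap_adj_iff)

lemma sum_swap_adj:
  assumes "finite F" "can_raise y F"
  shows "\<Sum>(swap_adj y F) = Suc (\<Sum>F)"
  using assms by (simp add: swap_adj_eq_insert can_raise_def sum.remove[of F y])

text \<open>Sending \<open>Suc y\<close> back to \<open>y\<close> injects each initial part of the
  swapped set into the same initial part of \<open>F\<close>.\<close>

lemma left_compression_swap_adj:
  assumes "finite F" "can_raise y F"
  shows "F \<le>LC swap_adj y F"
proof -
  let ?g = "\<lambda>x. if x = Suc y then y else x"
  have y: "y \<in> F" "Suc y \<notin> F" using assms by (auto simp: can_raise_def)
  have "card (swap_adj y F \<inter> {..i}) \<le> card (F \<inter> {..i})" for i
  proof (rule card_inj_on_le[of ?g])
    show "inj_on ?g (swap_adj y F \<inter> {..i})"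
      using y by (intro inj_onI) (auto simp: mem_swap_adj_iff split: if_splits)
    show "?g ` (swap_adj y F \<inter> {..i}) \<subseteq> F \<inter> {..i}"
      using y by (auto simp: mem_swap_adj_iff split: if_splits)
  qed (use assms in simp)
  moreover have "finite (swap_adj y F)" using assms by (simp add: swap_adj_eq_insert)
  ultimately show ?thesis using assms by (simp add: left_compression_iff)
qed

subsection \<open>A commutation identity\<close>

text \<open>Abel summation: \<open>y * (n - y)\<close> vanishes at both ends, and its increment from
  \<open>y\<close> to \<open>y + 1\<close> is \<open>n + 1 - 2 * (y + 1)\<close>.\<close>

lemma sum_by_parts_weights:
  fixes f :: "nat \<Rightarrow> real"
  shows "(\<Sum>y\<in>{1..<n}. real y * (real n - real y) * (f y - f (Suc y)))
       = (\<Sum>x\<in>{1..n}. (real n + 1 - 2 * real x) * f x)"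
proof -
  define c where "c y = real y * (real n - real y)" for y
  have *: "(\<Sum>y<m. c y * (f y - f (Suc y))) = (\<Sum>y<m. (c (Suc y) - c y) * f (Suc y)) - c m * f m" for m
    by (induction m) (simp_all add: c_def algebra_simps)
  have "(\<Sum>y\<in>{1..<n}. c y * (f y - f (Suc y))) = (\<Sum>y<n. c y * (f y - f (Suc y)))"
    by (rule sum.mono_neutral_left) (auto simp: c_def)
  also have "\<dots> = (\<Sum>y<n. (real n + 1 - 2 * real (Suc y)) * f (Suc y))"
    by (simp add: * ) (auto simp: c_def algebra_simps)
  also have "\<dots> = (\<Sum>x\<in>{1..n}. (real n + 1 - 2 * real x) * f x)"
    by (rule sum.reindex_bij_witness[of _ "\<lambda>x. x - 1" Suc]) auto
  finally show ?thesis by (simp add: c_def)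
qed

text \<open>The difference of the two indicators is the discrete difference of membership in
  \<open>F\<close>, so summation by parts applies. The right-hand side is the eigenvalue of
  \<open>H\<close> at \<open>F\<close>; the identity drives both the commutator and the bound on a
  level.\<close>

lemma sum_weights_raise_minus_lower:
  assumes "F \<subseteq> {1..n}"
  shows "(\<Sum>y\<in>{1..<n}. real y * (real n - real y) * (of_bool (can_raise y F) - of_bool (can_lower y F)))
       = (\<Sum>x\<in>F. real n + 1 - 2 * real x)"
proof -
  have "of_bool (can_raise y F) - of_bool (can_lower y F) = (of_bool (y \<in> F) - of_bool (Suc y \<in> F) :: real)" for y
    by (auto simp: can_raise_def can_lower_def)
  then have "(\<Sum>y\<in>{1..<n}. real y * (real n - real y) * (of_bool (can_raise y F) - of_bool (can_lower y F)))
       = (\<Sum>x\<in>{1..n}. (real n + 1 - 2 * real x) * of_bool (x \<in> F))"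
    by (simp only: sum_by_parts_weights[of n "\<lambda>x. of_bool (x \<in> F)"])
  also have "\<dots> = (\<Sum>x\<in>F. real n + 1 - 2 * real x)"
    using assms by (intro sum.mono_neutral_cong_right) auto
  finally show ?thesis .
qed

lemma sum_shift_swap_adj:
  assumes "y \<in> {1..<n}"
  shows "(\<Sum>F\<in>nsets {1..n} k. \<phi> (swap_adj y F)) = (\<Sum>F\<in>nsets {1..n} k. \<phi> F)"
  by (rule sum.reindex_bij_witness[of _ "swap_adj y" "swap_adj y"])
    (use swap_adj_nsets assms in auto)

text \<open>The raising operator \<open>X\<close> of the representation of \<open>sl\<^sub>2\<close> on the \<open>k\<close>-th exterior power of the
  \<open>n\<close>-dimensional irreducible one satisfies \<open>X\<^sup>* X - X X\<^sup>* = H\<close>; evaluated at a vector \<open>v\<close> this is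
  the following identity.\<close>

lemma raising_commutator:
  fixes v :: "nat set \<Rightarrow> real" and n k :: nat
  defines "w \<equiv> \<lambda>y. sqrt (real y * (real n - real y))"
  shows "(\<Sum>G\<in>nsets {1..n} k. (\<Sum>y\<in>{1..<n}. of_bool (can_lower y G) * w y * v (swap_adj y G))\<^sup>2)
       = (\<Sum>F\<in>nsets {1..n} k. (\<Sum>y\<in>{1..<n}. of_bool (can_raise y F) * w y * v (swap_adj y F))\<^sup>2)
         + (\<Sum>F\<in>nsets {1..n} k. (\<Sum>x\<in>F. real n + 1 - 2 * real x) * (v F)\<^sup>2)"
proof -
  let ?P = "nsets {1..n} k" and ?I = "{1..<n}"
  \<comment> \<open>\<open>D\<close> and \<open>U\<close> collect the mixed terms of the two squared
    norms after expansion.\<close>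
  define D where "D y z = (\<Sum>G\<in>?P. of_bool (can_lower y G) * of_bool (can_lower z G) * (v (swap_adj y G) * v (swap_adj z G)))" for y z
  define U where "U y z = (\<Sum>G\<in>?P. of_bool (can_raise y G) * of_bool (can_raise z G) * (v (swap_adj y G) * v (swap_adj z G)))" for y z
  have expand: "(\<Sum>G\<in>?P. (\<Sum>y\<in>?I. of_bool (R y G) * w y * v (swap_adj y G))\<^sup>2)
      = (\<Sum>y\<in>?I. \<Sum>z\<in>?I. w y * w z * (\<Sum>G\<in>?P. of_bool (R y G) * of_bool (R z G) * (v (swap_adj y G) * v (swap_adj z G))))"
    for R :: "nat \<Rightarrow> nat set \<Rightarrow> bool"
  proof -
    have "(\<Sum>G\<in>?P. (\<Sum>y\<in>?I. of_bool (R y G) * w y * v (swap_adj y G))\<^sup>2)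
        = (\<Sum>G\<in>?P. \<Sum>y\<in>?I. \<Sum>z\<in>?I. w y * w z * (of_bool (R y G) * of_bool (R z G) * (v (swap_adj y G) * v (swap_adj z G))))"
      by (simp add: power2_eq_square sum_product mult_ac)
    also have "\<dots> = (\<Sum>y\<in>?I. \<Sum>G\<in>?P. \<Sum>z\<in>?I. w y * w z * (of_bool (R y G) * of_bool (R z G) * (v (swap_adj y G) * v (swap_adj z G))))"
      by (rule sum.swap)
    also have "\<dots> = (\<Sum>y\<in>?I. \<Sum>z\<in>?I. \<Sum>G\<in>?P. w y * w z * (of_bool (R y G) * of_bool (R z G) * (v (swap_adj y G) * v (swap_adj z G))))"
      by (intro sum.cong refl sum.swap)
    finally show ?thesis by (simp only: sum_distrib_left)
  qed
  have off: "D y z = U y z" if yz: "y \<in> ?I" "z \<in> ?I" "y \<noteq> z" for y z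
  \<comment> \<open>For neighbouring positions both sides are zero, since the two conditions
    disagree on the shared element. For distant ones the swaps commute, and applying both of them as
    a substitution exchanges raising with lowering.\<close>
  proof (cases "z = Suc y \<or> y = Suc z")
    case True
    then have "D y z = 0" "U y z = 0"
      unfolding D_def U_def by (auto simp: can_lower_def can_raise_def intro!: sum.neutral)
    then show ?thesis by simp
  next
    case False
    then have far: "y \<noteq> z" "y \<noteq> Suc z" "z \<noteq> Suc y" using yz by auto
    have comm: "swap_adj y (swap_adj z F) = swap_adj z (swap_adj y F)" for F
      using far by (auto simp: set_eq_iff mem_swap_adj_iff)
    have keep: "can_raise y (swap_adj z F) = can_raise y F" "can_raise z (swap_adj y F) = can_raise z F" for F
      using far by (auto simp: can_raise_def mem_swap_adj_iff)
    have "U y z = (\<Sum>G\<in>?P. (\<lambda>G. of_bool (can_raise y G) * of_bool (can_raise z G) * (v (swap_adj y G) * v (swap_adj z G)))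
        (swap_adj y (swap_adj z G)))"
      unfolding U_def by (subst sum_shift_swap_adj[OF yz(2), symmetric], subst sum_shift_swap_adj[OF yz(1), symmetric])
        (simp add: comm)
    also have "\<dots> = D y z"
      unfolding D_def
    proof (rule sum.cong[OF refl])
      fix G
      have "swap_adj z (swap_adj y (swap_adj z G)) = swap_adj y G" by (simp add: comm[symmetric])
      moreover have "can_raise z (swap_adj y (swap_adj z G)) = can_lower z G"
        by (simp add: keep)
      moreover have "can_raise y (swap_adj y (swap_adj z G)) = can_lower y G"
        using keep by (simp add: comm)
      ultimately show "(\<lambda>G. of_bool (can_raise y G) * of_bool (can_raise z G) * (v (swap_adj y G) * v (swap_adj z G)))
          (swap_adj y (swap_adj z G)) =
        of_bool (can_lower y G) * of_bool (can_lower z G) * (v (swap_adj y G) * v (swap_adj z G))"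
        by simp
    qed
    finally show ?thesis by simp
  qed
  \<comment> \<open>On the diagonal one substitution moves the argument of \<open>v\<close> back to
    the summation variable, leaving the indicators of
    \<open>sum_weights_raise_minus_lower\<close>.\<close>
  have diag: "D y y - U y y = (\<Sum>F\<in>?P. (of_bool (can_raise y F) - of_bool (can_lower y F)) * (v F)\<^sup>2)"
    if y: "y \<in> ?I" for y
  proof -
    have "D y y = (\<Sum>F\<in>?P. of_bool (can_raise y F) * (v F)\<^sup>2)"
      unfolding D_def by (subst sum_shift_swap_adj[OF y, symmetric]) (simp add: power2_eq_square flip: of_bool_conj)
    moreover have "U y y = (\<Sum>F\<in>?P. of_bool (can_lower y F) * (v F)\<^sup>2)"
      unfolding U_def by (subst sum_shift_swap_adj[OF y, symmetric]) (simp add: power2_eq_square flip: of_bool_conj)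
    ultimately show ?thesis by (simp add: sum_subtractf left_diff_distrib)
  qed
  have "(\<Sum>G\<in>?P. (\<Sum>y\<in>?I. of_bool (can_lower y G) * w y * v (swap_adj y G))\<^sup>2)
      - (\<Sum>G\<in>?P. (\<Sum>y\<in>?I. of_bool (can_raise y G) * w y * v (swap_adj y G))\<^sup>2)
      = (\<Sum>y\<in>?I. \<Sum>z\<in>?I. w y * w z * (D y z - U y z))"
    unfolding expand by (simp add: D_def U_def sum_subtractf right_diff_distrib)
  also have "\<dots> = (\<Sum>y\<in>?I. \<Sum>z\<in>?I. if z = y then w y * w y * (D y y - U y y) else 0)"
    by (intro sum.cong refl) (auto simp: off)
  also have "\<dots> = (\<Sum>y\<in>?I. w y * w y * (D y y - U y y))"
    by simp
  also have "\<dots> = (\<Sum>y\<in>?I. \<Sum>F\<in>?P. real y * (real n - real y) *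
      (of_bool (can_raise y F) - of_bool (can_lower y F)) * (v F)\<^sup>2)"
    by (intro sum.cong refl) (auto simp: diag w_def sum_distrib_left mult.assoc)
  also have "\<dots> = (\<Sum>F\<in>?P. \<Sum>y\<in>?I. real y * (real n - real y) *
      (of_bool (can_raise y F) - of_bool (can_lower y F)) * (v F)\<^sup>2)"
    by (rule sum.swap)
  also have "\<dots> = (\<Sum>F\<in>?P. (\<Sum>x\<in>F. real n + 1 - 2 * real x) * (v F)\<^sup>2)"
    by (intro sum.cong refl, subst sum_distrib_right[symmetric], subst sum_weights_raise_minus_lower)
      (auto simp: nsets_def)
  finally show ?thesis by simp
qed

subsection \<open>Upper shadows below the middle\<close>

text \<open>Gaussian elimination, by induction on the set of equations.\<close>

lemma homogeneous_system_nontrivial_solution: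
  fixes M :: "'a \<Rightarrow> 'b \<Rightarrow> real"
  assumes "finite S" "finite N" "card N < card S"
  shows "\<exists>v. (\<exists>a\<in>S. v a \<noteq> 0) \<and> (\<forall>b\<in>N. (\<Sum>a\<in>S. M a b * v a) = 0)"
  using assms(2,1,3)
proof (induction N arbitrary: S M rule: finite_induct)
  case empty
  then have "S \<noteq> {}" by auto
  then show ?case by (intro exI[of _ "\<lambda>_. 1"]) auto
next
  case (insert b N)
  show ?case
  proof (cases "\<forall>a\<in>S. M a b = 0")
    case True
    obtain v where "\<exists>a\<in>S. v a \<noteq> 0" "\<forall>b\<in>N. (\<Sum>a\<in>S. M a b * v a) = 0"
      using insert.IH[of S M] insert.prems insert.hyps by auto
    then show ?thesis using True by (intro exI[of _ v]) auto
  next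
    case False
    then obtain a0 where a0: "a0 \<in> S" "M a0 b \<noteq> 0" by auto
    define S' where "S' = S - {a0}"
    \<comment> \<open>Row operation with pivot \<open>M a0 b\<close>: the unknown \<open>a0\<close>
      is eliminated from every other equation.\<close>
    define M' where "M' a c = M a c - M a0 c * M a b / M a0 b" for a c
    have S: "S = insert a0 S'" "a0 \<notin> S'" "finite S'" using a0 insert.prems by (auto simp: S'_def)
    then have "card N < card S'" using insert.prems insert.hyps by auto
    then obtain v where v: "\<exists>a\<in>S'. v a \<noteq> 0" "\<And>c. c \<in> N \<Longrightarrow> (\<Sum>a\<in>S'. M' a c * v a) = 0"
      using insert.IH[of S' M'] S by auto
    \<comment> \<open>The value of the unknown \<open>a0\<close> forced by equation
      \<open>b\<close>.\<close>
    define t where "t = - (\<Sum>a\<in>S'. M a b * v a) / M a0 b"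
    define v' where "v' = v(a0 := t)"
    have eq: "(\<Sum>a\<in>S. M a c * v' a) = M a0 c * t + (\<Sum>a\<in>S'. M a c * v a)" for c
    proof -
      have "(\<Sum>a\<in>S'. M a c * v' a) = (\<Sum>a\<in>S'. M a c * v a)"
        using S(2) by (intro sum.cong) (auto simp: v'_def)
      then show ?thesis using S by (simp add: v'_def)
    qed
    have "(\<Sum>a\<in>S. M a c * v' a) = 0" if c: "c \<in> N" for c
    proof -
      have "(\<Sum>a\<in>S'. M a c * v a) - M a0 c / M a0 b * (\<Sum>a\<in>S'. M a b * v a) = (\<Sum>a\<in>S'. M' a c * v a)"
        by (simp add: M'_def sum_distrib_left sum_subtractf algebra_simps)
      then show ?thesis using v(2)[OF c] by (simp add: eq t_def)
    qed
    moreover have "(\<Sum>a\<in>S. M a b * v' a) = 0"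
      using a0 by (simp add: eq t_def)
    moreover have "\<exists>a\<in>S. v' a \<noteq> 0" using v(1) S by (auto simp: v'_def)
    ultimately show ?thesis by (intro exI[of _ v']) auto
  qed
qed

definition upper_shadow :: "nat \<Rightarrow> nat set set \<Rightarrow> nat set set" where
  "upper_shadow n S = {swap_adj y F | y F. F \<in> S \<and> y \<in> {1..<n} \<and> can_raise y F}"

lemma upper_shadow_subset: "S \<subseteq> nsets {1..n} k \<Longrightarrow> upper_shadow n S \<subseteq> nsets {1..n} k"
  unfolding upper_shadow_def using swap_adj_nsets by blast

lemma sum_linear_nsets:
  assumes "F \<in> nsets A k"
  shows "(\<Sum>x\<in>F. real n + 1 - 2 * real x) = real k * (real n + 1) - 2 * real (\<Sum>F)"
  using assms by (simp add: nsets_def sum_subtractf flip: sum_distrib_left)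

text \<open>A smaller shadow would give a nonzero vector supported on \<open>S\<close> and killed by
  the raising operator. In \<open>raising_commutator\<close> the left side is then zero, while the
  right side is positive because all weights on \<open>S\<close> are.\<close>

lemma card_le_card_upper_shadow:
  assumes S: "S \<subseteq> nsets {1..n} k" and sum: "\<And>F. F \<in> S \<Longrightarrow> \<Sum>F = s" and s: "2 * s < k * (n + 1)"
  shows "card S \<le> card (upper_shadow n S)"
proof (rule ccontr)
  let ?P = "nsets {1..n} k"
  define w where "w y = sqrt (real y * (real n - real y))" for y
  define M where "M F G = (\<Sum>y\<in>{1..<n}. of_bool (can_lower y G) * w y * of_bool (swap_adj y G = F))" for F G
  assume "\<not> card S \<le> card (upper_shadow n S)"
  moreover have finP: "finite ?P" by (simp add: finite_imp_finite_nsets)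
  moreover have finS: "finite S" using finP S by (rule finite_subset[rotated])
  moreover have "finite (upper_shadow n S)"
    using finP upper_shadow_subset[OF S] by (rule finite_subset[rotated])
  ultimately obtain v where v: "\<exists>F\<in>S. v F \<noteq> 0" "\<And>G. G \<in> upper_shadow n S \<Longrightarrow> (\<Sum>F\<in>S. M F G * v F) = 0"
    using homogeneous_system_nontrivial_solution[of S "upper_shadow n S" M] by auto
  define u where "u F = (if F \<in> S then v F else 0)" for F
  \<comment> \<open>Inside the shadow this is the system solved by \<open>v\<close>; outside it no
    lowering of \<open>G\<close> lies in \<open>S\<close>, so every term vanishes.\<close>
  have zero: "(\<Sum>y\<in>{1..<n}. of_bool (can_lower y G) * w y * u (swap_adj y G)) = 0" if "G \<in> ?P" for G
  proof (cases "G \<in> upper_shadow n S")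
    case True
    have "u H = (\<Sum>F\<in>S. of_bool (H = F) * v F)" for H
      using finS by (simp add: u_def of_bool_def if_distrib[of "\<lambda>x. x * _"] cong: if_cong)
    then have "(\<Sum>y\<in>{1..<n}. of_bool (can_lower y G) * w y * u (swap_adj y G))
        = (\<Sum>y\<in>{1..<n}. \<Sum>F\<in>S. of_bool (can_lower y G) * w y * of_bool (swap_adj y G = F) * v F)"
      by (simp add: sum_distrib_left mult.assoc)
    also have "\<dots> = (\<Sum>F\<in>S. M F G * v F)"
      unfolding M_def sum_distrib_right by (rule sum.swap)
    finally show ?thesis using v(2)[OF True] by simp
  next
    case False
    have "u (swap_adj y G) = 0" if "y \<in> {1..<n}" "can_lower y G" for y
    proof -
      have "swap_adj y G \<notin> S"
      proof
        assume "swap_adj y G \<in> S"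
        then have "swap_adj y (swap_adj y G) \<in> upper_shadow n S"
          unfolding upper_shadow_def using that by (intro CollectI exI[of _ y] exI[of _ "swap_adj y G"]) simp
        then show False using False by simp
      qed
      then show ?thesis by (simp add: u_def)
    qed
    then show ?thesis by (intro sum.neutral) auto
  qed
  have "(\<Sum>G\<in>?P. (\<Sum>y\<in>{1..<n}. of_bool (can_lower y G) * w y * u (swap_adj y G))\<^sup>2) = 0"
    using zero by simp
  moreover have "0 \<le> (\<Sum>F\<in>?P. (\<Sum>y\<in>{1..<n}. of_bool (can_raise y F) * w y * u (swap_adj y F))\<^sup>2)"
    by (intro sum_nonneg) simp
  ultimately have "(\<Sum>F\<in>?P. (\<Sum>x\<in>F. real n + 1 - 2 * real x) * (u F)\<^sup>2) \<le> 0"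
    using raising_commutator[where v = u and n = n and k = k] unfolding w_def by linarith
  moreover have "0 < (\<Sum>F\<in>?P. (\<Sum>x\<in>F. real n + 1 - 2 * real x) * (u F)\<^sup>2)"
  proof -
    have pos: "(\<Sum>x\<in>F. real n + 1 - 2 * real x) > 0" if "F \<in> S" for F
    proof -
      have "F \<in> ?P" using S that by blast
      then have "(\<Sum>x\<in>F. real n + 1 - 2 * real x) = real (k * (n + 1)) - real (2 * s)"
        using sum_linear_nsets[of F "{1..n}" k n] sum[OF that] by (simp add: algebra_simps)
      moreover have "real (2 * s) < real (k * (n + 1))" using s by (simp only: of_nat_less_iff)
      ultimately show ?thesis by linarith
    qed
    obtain F where "F \<in> S" "v F \<noteq> 0" using v(1) by blast
    then have "0 < (\<Sum>x\<in>F. real n + 1 - 2 * real x) * (u F)\<^sup>2"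
      using pos by (simp add: u_def)
    moreover have "0 \<le> (\<Sum>x\<in>G. real n + 1 - 2 * real x) * (u G)\<^sup>2" for G
      using pos[of G] by (cases "G \<in> S") (simp_all add: u_def)
    ultimately show ?thesis
      using finP S \<open>F \<in> S\<close> by (intro sum_pos2[of _ F]) auto
  qed
  ultimately show False by linarith
qed

subsection \<open>Pushing antichains to the middle\<close>

text \<open>The members on the lowest level \<open>s\<close> are replaced by their upper shadow,
  which is at least as large.\<close>

lemma antichain_push_up_step:
  assumes A: "\<A> \<subseteq> nsets {1..n} k" "LC_antichain \<A>"
    and sums: "\<And>F. F \<in> \<A> \<Longrightarrow> s \<le> \<Sum>F \<and> \<Sum>F \<le> t" and s: "2 * s < k * (n + 1)" "s < t"
  shows "\<exists>\<B>\<subseteq>nsets {1..n} k. LC_antichain \<B> \<and> card \<A> \<le> card \<B> \<and> (\<forall>F\<in>\<B>. Suc s \<le> \<Sum>F \<and> \<Sum>F \<le> t)"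
proof -
  define L where "L = {F \<in> \<A>. \<Sum>F = s}"
  define N where "N = upper_shadow n L"
  define H where "H = \<A> - L"
  have fin: "finite F" if "F \<in> nsets {1..n} k" for F using that by (simp add: nsets_def)
  have finA: "finite \<A>" by (rule finite_subset[OF A(1)]) (simp add: finite_imp_finite_nsets)
  have LP: "L \<subseteq> nsets {1..n} k" using A by (auto simp: L_def)
  have NP: "N \<subseteq> nsets {1..n} k" unfolding N_def by (rule upper_shadow_subset[OF LP])
  have HP: "H \<subseteq> nsets {1..n} k" using A by (auto simp: H_def)
  have N: "\<exists>F\<in>L. F \<le>LC G" "\<Sum>G = Suc s" if "G \<in> N" for G
  proof -
    obtain y F where F: "G = swap_adj y F" "F \<in> L" "can_raise y F"
      using \<open>G \<in> N\<close> by (auto simp: N_def upper_shadow_def)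
    then show "\<exists>F\<in>L. F \<le>LC G" using left_compression_swap_adj fin LP by blast
    show "\<Sum>G = Suc s" using F sum_swap_adj[of F y] fin LP by (auto simp: L_def)
  qed
  have H: "Suc s \<le> \<Sum>F" if "F \<in> H" for F
    using sums[of F] that by (auto simp: H_def L_def)
  \<comment> \<open>A remaining member above a shadow element would be above a member of
    \<open>L\<close>.\<close>
  have cross: "\<not> G \<le>LC F" if "G \<in> N" "F \<in> H" for F G
  proof
    assume "G \<le>LC F"
    then obtain E where "E \<in> L" "E \<le>LC F" using N(1)[OF \<open>G \<in> N\<close>] left_compression_trans by blast
    then show False using A(2) that by (auto simp: LC_antichain_def L_def H_def)
  qed
  \<comment> \<open>In this direction sums suffice: a member of \<open>H\<close> has sum at least
    \<open>Suc s\<close>, the sum of every shadow element.\<close>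
  have cross': "F = G" if "G \<in> N" "F \<in> H" "F \<le>LC G" for F G
    using that left_compression_sum_eq[of F G] left_compression_sum_le[of F G] fin NP HP H N(2)
    by (metis order_antisym subsetD)
  have "N \<inter> H = {}" using cross left_compression_refl by blast
  moreover have "finite N" using NP by (rule finite_subset) (simp add: finite_imp_finite_nsets)
  moreover have "finite H" using finA by (simp add: H_def)
  ultimately have "card (N \<union> H) = card N + card H" by (intro card_Un_disjoint)
  moreover have "card L \<le> card N"
    unfolding N_def using LP s by (intro card_le_card_upper_shadow[where k = k and s = s]) (auto simp: L_def)
  moreover have "card \<A> = card L + card H"
    unfolding H_def using finA by (subst card_Diff_subset) (auto simp: L_def card_mono)
  ultimately have "card \<A> \<le> card (N \<union> H)" by simp
  moreover have "LC_antichain (N \<union> H)"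
    unfolding LC_antichain_def
  proof (intro ballI impI)
    fix F G assume FG: "F \<in> N \<union> H" "G \<in> N \<union> H" and le: "F \<le>LC G"
    consider "F \<in> N" "G \<in> N" | "F \<in> N" "G \<in> H" | "F \<in> H" "G \<in> N" | "F \<in> H" "G \<in> H"
      using FG by blast
    then show "F = G"
    proof cases
      case 1
      then show ?thesis using left_compression_sum_eq[OF _ _ le] fin NP N(2) by (metis subsetD)
    next
      case 2
      then show ?thesis using cross le by blast
    next
      case 3
      then show ?thesis using cross' le by blast
    next
      case 4
      then show ?thesis using A(2) le by (auto simp: LC_antichain_def H_def)
    qed
  qed
  moreover have "Suc s \<le> \<Sum>F \<and> \<Sum>F \<le> t" if "F \<in> N \<union> H" for F
    using that N(2) H sums s by (auto simp: H_def)
  ultimately show ?thesis using NP HP by (intro exI[of _ "N \<union> H"]) auto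
qed

text \<open>The bound on \<open>m\<close> says that the last level left behind,
  \<open>m - 1\<close>, is still strictly below the middle.\<close>

lemma antichain_push_up:
  assumes A: "\<A> \<subseteq> nsets {1..n} k" "LC_antichain \<A>"
    and "\<And>F. F \<in> \<A> \<Longrightarrow> \<Sum>F \<le> t" and "2 * m < k * (n + 1) + 2" "m \<le> t"
  shows "\<exists>\<B>\<subseteq>nsets {1..n} k. LC_antichain \<B> \<and> card \<A> \<le> card \<B> \<and> (\<forall>F\<in>\<B>. m \<le> \<Sum>F \<and> \<Sum>F \<le> t)"
  using assms(4,5)
proof (induction m)
  case 0
  then show ?case using assms by (intro exI[of _ \<A>]) auto
next
  case (Suc m)
  then obtain \<B> where B: "\<B> \<subseteq> nsets {1..n} k" "LC_antichain \<B>" "card \<A> \<le> card \<B>"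
    "\<And>F. F \<in> \<B> \<Longrightarrow> m \<le> \<Sum>F \<and> \<Sum>F \<le> t" by auto
  then obtain \<C> where "\<C> \<subseteq> nsets {1..n} k" "LC_antichain \<C>" "card \<B> \<le> card \<C>"
    "\<forall>F\<in>\<C>. Suc m \<le> \<Sum>F \<and> \<Sum>F \<le> t"
    using antichain_push_up_step[OF B(1,2,4)] Suc.prems by auto
  then show ?case using B(3) by (meson order_trans)
qed

text \<open>Push the antichain up to sums at least \<open>m\<close>, complement it, which brings the
  sums down to at most \<open>m\<close>, and push up again. Everything then sits on level
  \<open>m\<close>.\<close>

lemma card_antichain_le_middle_level:
  assumes A: "\<A> \<subseteq> nsets {1..2 * k} k" "LC_antichain \<A>"
  shows "card \<A> \<le> card {F \<in> nsets {1..2 * k} k. \<Sum>F = (k * (2 * k + 1) + 1) div 2}"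
proof -
  let ?P = "nsets {1..2 * k} k" and ?c = "\<lambda>F. {1..2 * k} - F"
  define T where "T = k * (2 * k + 1)"
  \<comment> \<open>Half of the total \<open>T\<close>, rounded up: level \<open>m - 1\<close> is
    below the middle, and complements of sets of sum at least \<open>m\<close> have sum at most
    \<open>T - m \<le> m\<close>.\<close>
  define m where "m = (T + 1) div 2"
  have m: "2 * m < T + 2" "T - m \<le> m" "m \<le> T"
  proof -
    show "2 * m < T + 2" "T - m \<le> m" by (auto simp: m_def)
    show "m \<le> T" by (cases "T = 0") (auto simp: m_def)
  qed
  have sumT: "\<Sum>(?c F) + \<Sum>F = T" if "F \<in> ?P" for F
    using that sum_complement[of F k] by (simp add: nsets_def T_def)
  have "\<exists>\<B>\<subseteq>?P. LC_antichain \<B> \<and> card \<A> \<le> card \<B> \<and> (\<forall>F\<in>\<B>. m \<le> \<Sum>F \<and> \<Sum>F \<le> T)"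
  proof (rule antichain_push_up[OF A])
    show "\<Sum>F \<le> T" if "F \<in> \<A>" for F using sumT[of F] that A(1) by auto
  qed (use m in \<open>auto simp: T_def\<close>)
  then obtain \<B> where B: "\<B> \<subseteq> ?P" "LC_antichain \<B>" "card \<A> \<le> card \<B>" "\<And>F. F \<in> \<B> \<Longrightarrow> m \<le> \<Sum>F"
    by blast
  have double: "?c (?c F) = F" if "F \<in> ?P" for F using that by (auto simp: nsets_def)
  have cB: "?c ` \<B> \<subseteq> ?P" using B card_complement by blast
  have "LC_antichain (?c ` \<B>)"
    unfolding LC_antichain_def
  proof (intro ballI impI)
    fix F' G' assume "F' \<in> ?c ` \<B>" "G' \<in> ?c ` \<B>" and le: "F' \<le>LC G'"
    then obtain F G where FG: "F \<in> \<B>" "G \<in> \<B>" "F' = ?c F" "G' = ?c G" by blast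
    then have "?c G' \<le>LC ?c F'" using left_compression_complement[of F' k G'] le cB by blast
    moreover have "?c G' = G" "?c F' = F"
      unfolding FG(3,4) using FG(1,2) B(1) by (blast intro!: double)+
    ultimately have "G \<le>LC F" by metis
    then show "F' = G'" using B(2) FG by (auto simp: LC_antichain_def)
  qed
  moreover have "\<Sum>F \<le> m" if "F \<in> ?c ` \<B>" for F
    using that sumT B(1,4) m by (fastforce simp: subset_iff)
  ultimately have "\<exists>\<C>\<subseteq>?P. LC_antichain \<C> \<and> card (?c ` \<B>) \<le> card \<C> \<and> (\<forall>F\<in>\<C>. m \<le> \<Sum>F \<and> \<Sum>F \<le> m)"
    using cB m by (intro antichain_push_up) (auto simp: T_def)
  then obtain \<C> where C: "\<C> \<subseteq> ?P" "card (?c ` \<B>) \<le> card \<C>" "\<And>F. F \<in> \<C> \<Longrightarrow> \<Sum>F = m"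
    by (metis order_antisym)
  have "inj_on ?c \<B>" using double B(1) by (intro inj_onI) (metis subsetD)
  then have "card \<A> \<le> card \<C>" using B(3) C(2) by (simp add: card_image)
  also have "\<dots> \<le> card {F \<in> ?P. \<Sum>F = m}"
    using C by (intro card_mono) (auto simp: finite_imp_finite_nsets)
  finally show ?thesis by (simp add: m_def T_def)
qed

section \<open>The distribution of the sum of a random set\<close>

lemma card_nsets_in_notin:
  assumes "finite S" "x \<in> S" "y \<in> S" "x \<noteq> y" "k > 0"
  shows "card {F \<in> nsets S k. x \<in> F \<and> y \<notin> F} = (card S - 2) choose (k - 1)"
proof -
  have "{F \<in> nsets S k. x \<in> F \<and> y \<notin> F} = insert x ` nsets (S - {x, y}) (k - 1)"
  proof (intro equalityI subsetI)
    fix F assume F: "F \<in> {F \<in> nsets S k. x \<in> F \<and> y \<notin> F}"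
    then have "F - {x} \<in> nsets (S - {x, y}) (k - 1)" "insert x (F - {x}) = F"
      by (auto simp: nsets_def)
    then show "F \<in> insert x ` nsets (S - {x, y}) (k - 1)" by (metis imageI)
  next
    fix F assume "F \<in> insert x ` nsets (S - {x, y}) (k - 1)"
    then obtain G where "F = insert x G" "G \<subseteq> S - {x, y}" "finite G" "card G = k - 1"
      by (auto simp: nsets_def)
    moreover from this have "x \<notin> G" by auto
    ultimately show "F \<in> {F \<in> nsets S k. x \<in> F \<and> y \<notin> F}"
      using assms by (auto simp: nsets_def)
  qed
  moreover have "inj_on (insert x) (nsets (S - {x, y}) (k - 1))"
  proof (rule inj_onI)
    fix F G assume "F \<in> nsets (S - {x, y}) (k - 1)" "G \<in> nsets (S - {x, y}) (k - 1)"
      and "insert x F = insert x G"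
    moreover from this have "x \<notin> F" "x \<notin> G" by (auto simp: nsets_def)
    ultimately show "F = G" by (metis insert_ident)
  qed
  moreover have "card (S - {x, y}) = card S - 2"
    using assms by (subst card_Diff_subset) auto
  ultimately show ?thesis by (simp add: card_image card_nsets)
qed

text \<open>Since the weights add up to zero, the square of the weight of \<open>F\<close> is minus the product of the
  weights of \<open>F\<close> and of its complement.\<close>

lemma sum_nsets_square:
  fixes b :: "'a \<Rightarrow> real"
  assumes "finite S" "(\<Sum>x\<in>S. b x) = 0" "k > 0"
  shows "(\<Sum>F\<in>nsets S k. (\<Sum>x\<in>F. b x)\<^sup>2) = real ((card S - 2) choose (k - 1)) * (\<Sum>x\<in>S. (b x)\<^sup>2)"
proof -
  let ?C = "real ((card S - 2) choose (k - 1))"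
  have sq: "(\<Sum>x\<in>F. b x)\<^sup>2 = - (\<Sum>x\<in>S. \<Sum>y\<in>S. of_bool (x \<in> F \<and> y \<notin> F) * (b x * b y))"
    if "F \<in> nsets S k" for F
  proof -
    have F: "F \<subseteq> S" using that by (simp add: nsets_def)
    have "(\<Sum>x\<in>S. \<Sum>y\<in>S. of_bool (x \<in> F \<and> y \<notin> F) * (b x * b y))
        = (\<Sum>x\<in>S. of_bool (x \<in> F) * b x) * (\<Sum>y\<in>S. of_bool (y \<notin> F) * b y)"
      by (simp add: sum_product of_bool_conj mult_ac)
    also have "(\<Sum>x\<in>S. of_bool (x \<in> F) * b x) = (\<Sum>x\<in>F. b x)"
      using F assms(1) by (intro sum.mono_neutral_cong_right) auto
    also have "(\<Sum>y\<in>S. of_bool (y \<notin> F) * b y) = (\<Sum>y\<in>S - F. b y)"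
      using assms(1) by (intro sum.mono_neutral_cong_right) auto
    also have "\<dots> = - (\<Sum>x\<in>F. b x)"
      using F assms(1,2) by (simp add: sum_diff)
    finally show ?thesis by (simp add: power2_eq_square)
  qed
  have "(\<Sum>F\<in>nsets S k. (\<Sum>x\<in>F. b x)\<^sup>2)
      = - (\<Sum>F\<in>nsets S k. \<Sum>x\<in>S. \<Sum>y\<in>S. of_bool (x \<in> F \<and> y \<notin> F) * (b x * b y))"
    by (simp add: sq sum_negf)
  also have "(\<Sum>F\<in>nsets S k. \<Sum>x\<in>S. \<Sum>y\<in>S. of_bool (x \<in> F \<and> y \<notin> F) * (b x * b y))
      = (\<Sum>x\<in>S. \<Sum>F\<in>nsets S k. \<Sum>y\<in>S. of_bool (x \<in> F \<and> y \<notin> F) * (b x * b y))"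
    by (rule sum.swap)
  also have "\<dots> = (\<Sum>x\<in>S. \<Sum>y\<in>S. \<Sum>F\<in>nsets S k. of_bool (x \<in> F \<and> y \<notin> F) * (b x * b y))"
    by (intro sum.cong refl sum.swap)
  \<comment> \<open>The count is the same for all \<open>x \<noteq> y\<close> and zero on the
    diagonal, so a full double sum minus its diagonal appears; the full one vanishes by
    centring.\<close>
  also have "\<dots> = (\<Sum>x\<in>S. \<Sum>y\<in>S. ?C * (b x * b y) - (if y = x then ?C * (b x * b x) else 0))"
  proof (intro sum.cong refl)
    fix x y assume xy: "x \<in> S" "y \<in> S"
    have fin: "finite (nsets S k)" using assms(1) by (simp add: finite_imp_finite_nsets)
    have "(\<Sum>F\<in>nsets S k. of_bool (x \<in> F \<and> y \<notin> F)) = real (card {F \<in> nsets S k. x \<in> F \<and> y \<notin> F})"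
      using fin by (simp add: of_bool_def sum.If_cases Int_def)
    also have "\<dots> = (if y = x then 0 else ?C)"
      using card_nsets_in_notin[OF assms(1) xy] assms(3) by auto
    finally have c: "(\<Sum>F\<in>nsets S k. of_bool (x \<in> F \<and> y \<notin> F)) = (if y = x then 0 else ?C)" .
    show "(\<Sum>F\<in>nsets S k. of_bool (x \<in> F \<and> y \<notin> F) * (b x * b y))
        = ?C * (b x * b y) - (if y = x then ?C * (b x * b x) else 0)"
      unfolding sum_distrib_right[symmetric] c by simp
  qed
  also have "\<dots> = ?C * (\<Sum>x\<in>S. \<Sum>y\<in>S. b x * b y) - ?C * (\<Sum>x\<in>S. (b x)\<^sup>2)"
    using assms(1) by (simp add: sum_subtractf sum_distrib_left power2_eq_square)
  also have "(\<Sum>x\<in>S. \<Sum>y\<in>S. b x * b y) = 0"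
    using assms(2) by (simp flip: sum_product)
  finally show ?thesis by simp
qed

text \<open>Expresses the number of \<open>k\<close>-sets containing one given point and missing
  another as the fraction \<open>k (n - k) / (n (n - 1))\<close> of all
  \<open>k\<close>-sets.\<close>

lemma binomial_minus2_absorb:
  assumes "k > 0" "n \<ge> 2"
  shows "real ((n - 2) choose (k - 1)) * (real n * (real n - 1)) = real (n choose k) * (real k * (real n - real k))"
proof (cases "k \<le> n")
  case True
  obtain m where n: "n = Suc (Suc m)" using assms(2) by (metis add_2_eq_Suc le_Suc_ex)
  obtain j where k: "k = Suc j" using assms(1) by (cases k) auto
  have "Suc j * (Suc (Suc m) choose Suc j) = Suc (Suc m) * (Suc m choose j)"
    using Suc_times_binomial_eq[of "Suc m" j] by (simp only: mult.commute)
  moreover have "(Suc m - j) * (Suc m choose j) = Suc m * (m choose j)"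
    using binomial_absorb_comp[of "Suc m" j] by simp
  moreover have j: "j \<le> Suc m" using True n k by simp
  ultimately have "real (Suc j) * real (n choose k) = real n * real (Suc m choose j)"
    "(real (Suc m) - real j) * real (Suc m choose j) = real (Suc m) * real (m choose j)"
    unfolding n k using j by (metis of_nat_mult, metis of_nat_mult of_nat_diff)
  then have "real n * (real (Suc m) * real (m choose j)) = (real (Suc m) - real j) * (real (Suc j) * real (n choose k))"
    by (metis mult.left_commute)
  then show ?thesis by (simp add: n k algebra_simps)
qed (use assms in \<open>simp add: binomial_eq_0\<close>)

section \<open>Moments of the sum\<close>

lemma sum_centered: "(\<Sum>x\<in>{1..n}. real n + 1 - 2 * real x) = 0"
proof -
  \<comment> \<open>For the induction, the constant \<open>a\<close> is separated from the upper
    limit.\<close>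
  have "(\<Sum>x\<in>{1..m}. a - 2 * real x) = real m * (a - 1 - real m)" for m and a :: real
    by (induction m) (auto simp: algebra_simps)
  then show ?thesis by simp
qed

lemma sum_centered_square: "3 * (\<Sum>x\<in>{1..n}. (real n + 1 - 2 * real x)\<^sup>2) = real n * (real n - 1) * (real n + 1)"
proof -
  have "3 * (\<Sum>x\<in>{1..m}. (a - 2 * real x)\<^sup>2)
      = 2 * real m * (real m + 1) * (2 * real m + 1) - 6 * a * real m * (real m + 1) + 3 * a\<^sup>2 * real m"
    for m and a :: real
    by (induction m) (auto simp: algebra_simps power2_eq_square)
  then have "3 * (\<Sum>x\<in>{1..n}. (real n + 1 - 2 * real x)\<^sup>2)
      = 2 * real n * (real n + 1) * (2 * real n + 1) - 6 * (real n + 1) * real n * (real n + 1) + 3 * (real n + 1)\<^sup>2 * real n" .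
  also have "\<dots> = real n * (real n - 1) * (real n + 1)" by (simp add: algebra_simps power2_eq_square)
  finally show ?thesis .
qed

text \<open>The variance of the centred, doubled sum of a random \<open>k\<close>-set is
  \<open>k (n - k) (n + 1) / 3\<close>; denominators are cleared.\<close>

lemma sum_deviation_square:
  assumes "k > 0" "n \<ge> 2"
  shows "3 * (\<Sum>F\<in>nsets {1..n} k. (\<Sum>x\<in>F. real n + 1 - 2 * real x)\<^sup>2)
       = real (n choose k) * (real k * (real n - real k) * (real n + 1))"
proof -
  have "3 * (\<Sum>F\<in>nsets {1..n} k. (\<Sum>x\<in>F. real n + 1 - 2 * real x)\<^sup>2)
      = real ((n - 2) choose (k - 1)) * (3 * (\<Sum>x\<in>{1..n}. (real n + 1 - 2 * real x)\<^sup>2))"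
    using sum_nsets_square[OF _ sum_centered assms(1), of n] by simp
  also have "\<dots> = real ((n - 2) choose (k - 1)) * (real n * (real n - 1)) * (real n + 1)"
    by (simp only: sum_centered_square mult.assoc)
  also have "\<dots> = real (n choose k) * (real k * (real n - real k) * (real n + 1))"
    by (simp only: binomial_minus2_absorb[OF assms] mult.assoc)
  finally show ?thesis .
qed

text \<open>Pigeonhole over the sums within \<open>\<surd>3\<close> standard deviations of the mean, the choice which
  optimises the constant in Chebyshev's inequality.\<close>

lemma exists_large_sum_level:
  assumes "k \<ge> 2"
  shows "\<exists>s. 2 / 3 * real ((2 * k - 2) choose k) \<le>
      (sqrt 2 * real k powr (3 / 2) + 1) * real (card {F \<in> nsets {1..2 * k - 2} k. \<Sum>F = s})"
proof (rule ccontr)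
  assume neg: "\<nexists>s. 2 / 3 * real ((2 * k - 2) choose k) \<le>
      (sqrt 2 * real k powr (3 / 2) + 1) * real (card {F \<in> nsets {1..2 * k - 2} k. \<Sum>F = s})"
  define n where "n = 2 * k - 2"
  define N where "N = real (n choose k)"
  \<comment> \<open>For \<open>n = 2 * k - 2\<close> the variance is at most
    \<open>2 * k ^ 3 / 3\<close>, one third of the square of \<open>t\<close>, so Chebyshev's
    inequality discards at most a third of the sets.\<close>
  define t where "t = sqrt 2 * real k powr (3 / 2)"
  define h where "h F = (\<Sum>x\<in>F. real n + 1 - 2 * real x)" for F
  define G where "G = {F \<in> nsets {1..n} k. (h F)\<^sup>2 < t\<^sup>2}"
  have n: "real n = 2 * real k - 2" "n \<ge> 2" using assms by (auto simp: n_def)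
  have finP: "finite (nsets {1..n} k)" by (simp add: finite_imp_finite_nsets)
  have t2: "t\<^sup>2 = 2 * real k ^ 3"
  proof -
    have "(real k powr (3 / 2))\<^sup>2 = real k powr 3"
      using powr_add[of "real k" "3 / 2" "3 / 2"] by (simp add: power2_eq_square)
    then show ?thesis using assms by (simp add: t_def power_mult_distrib)
  qed
  have t0: "t \<ge> 0" by (simp add: t_def)
  have hF: "h F = real k * (real n + 1) - 2 * real (\<Sum>F)" if "F \<in> nsets {1..n} k" for F
    unfolding h_def by (rule sum_linear_nsets[OF that])
  have "t\<^sup>2 * real (card (nsets {1..n} k - G)) \<le> (\<Sum>F\<in>nsets {1..n} k - G. (h F)\<^sup>2)"
    using sum_bounded_below[of "nsets {1..n} k - G" "t\<^sup>2" "\<lambda>F. (h F)\<^sup>2"]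
    by (simp add: G_def mult.commute not_less)
  also have "\<dots> \<le> (\<Sum>F\<in>nsets {1..n} k. (h F)\<^sup>2)"
    using finP by (intro sum_mono2) auto
  also have "\<dots> = N * (real k * (real k - 2) * (2 * real k - 1)) / 3"
    using sum_deviation_square[of k n] assms n by (simp add: h_def N_def)
  also have "\<dots> \<le> N * (2 * real k ^ 3) / 3"
  proof -
    have "(real k - 2) * (2 * real k - 1) \<le> real k * (2 * real k)"
      using assms by (intro mult_mono) auto
    then have "real k * ((real k - 2) * (2 * real k - 1)) \<le> real k * (real k * (2 * real k))"
      by (intro mult_left_mono) auto
    then show ?thesis
      by (intro divide_right_mono mult_left_mono) (auto simp: N_def power3_eq_cube mult_ac)
  qed
  finally have "2 * real k ^ 3 * real (card (nsets {1..n} k - G)) \<le> 2 * real k ^ 3 * (N / 3)"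
    by (simp add: t2)
  then have "real (card (nsets {1..n} k - G)) \<le> N / 3"
    using assms by simp
  moreover have "real (card (nsets {1..n} k - G)) = N - real (card G)"
  proof -
    have "G \<subseteq> nsets {1..n} k" by (auto simp: G_def)
    then have "card (nsets {1..n} k - G) + card G = card (nsets {1..n} k)"
      using finP card_mono[of "nsets {1..n} k" G] by (simp add: card_Diff_subset finite_subset)
    then show ?thesis by (simp add: N_def card_nsets)
  qed
  ultimately have cG: "2 / 3 * N \<le> real (card G)" by simp
  have "N > 0" using assms by (auto simp: N_def n_def)
  then have "G \<noteq> {}" using cG by auto
  have finG: "finite G" using finP by (simp add: G_def)
  define S where "S = Sum ` G"
  have S: "finite S" "S \<noteq> {}" using finG \<open>G \<noteq> {}\<close> by (auto simp: S_def)
  have "card S \<le> card {Min S..Max S}"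
    using S by (intro card_mono) auto
  then have "card S + Min S \<le> Max S + 1"
    using Min_le[OF S(1) Max_in[OF S]] by simp
  then have "real (card S) \<le> real (Max S) - real (Min S) + 1" by linarith
  \<comment> \<open>\<open>h\<close> changes by 2 when the sum changes by 1, so the window of width
    \<open>2 * t\<close> for \<open>h\<close> has width \<open>t\<close> for the sum.\<close>
  also have "\<dots> \<le> t + 1"
  proof -
    obtain F1 F2 where F: "F1 \<in> G" "Max S = \<Sum>F1" "F2 \<in> G" "Min S = \<Sum>F2"
      using Max_in[OF S] Min_in[OF S] by (auto simp: S_def)
    have "\<bar>h F1\<bar> < t" "\<bar>h F2\<bar> < t"
      using F t0 by (auto simp: G_def intro: power2_less_imp_less)
    moreover have "h F1 = real k * (real n + 1) - 2 * real (\<Sum>F1)" "h F2 = real k * (real n + 1) - 2 * real (\<Sum>F2)"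
      using F hF by (auto simp: G_def)
    ultimately show ?thesis using F by linarith
  qed
  finally have cS: "real (card S) \<le> t + 1" .
  have "card G \<le> (\<Sum>s\<in>S. card {F \<in> G. \<Sum>F = s})"
  proof -
    have "G = (\<Union>s\<in>S. {F \<in> G. \<Sum>F = s})" by (auto simp: S_def)
    then show ?thesis using card_UN_le[OF S(1), of "\<lambda>s. {F \<in> G. \<Sum>F = s}"] by simp
  qed
  then have "real (card G) \<le> real (\<Sum>s\<in>S. card {F \<in> G. \<Sum>F = s})"
    by (simp only: of_nat_le_iff)
  also have "\<dots> = (\<Sum>s\<in>S. real (card {F \<in> G. \<Sum>F = s}))" by simp
  also have "\<dots> < (\<Sum>s\<in>S. 2 / 3 * N / (t + 1))"
  proof (rule sum_strict_mono[OF S])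
    fix s
    have "card {F \<in> G. \<Sum>F = s} \<le> card {F \<in> nsets {1..n} k. \<Sum>F = s}"
      using finP by (intro card_mono) (auto simp: G_def)
    then have "real (card {F \<in> G. \<Sum>F = s}) * (t + 1) \<le> real (card {F \<in> nsets {1..n} k. \<Sum>F = s}) * (t + 1)"
      using t0 by (intro mult_right_mono) auto
    also have "\<dots> < 2 / 3 * N"
      using neg by (simp add: N_def n_def t_def not_le mult.commute)
    finally show "real (card {F \<in> G. \<Sum>F = s}) < 2 / 3 * N / (t + 1)"
      using t0 by (simp only: pos_less_divide_eq add_nonneg_pos zero_less_one)
  qed
  also have "\<dots> = real (card S) * (2 / 3 * N / (t + 1))" by simp
  also have "\<dots> \<le> (t + 1) * (2 / 3 * N / (t + 1))"
    using cS t0 \<open>N > 0\<close> by (intro mult_right_mono) auto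
  also have "\<dots> = 2 / 3 * N"
    unfolding times_divide_eq_right by (rule nonzero_mult_div_cancel_left) (use t0 in simp)
  finally show False using cG by simp
qed

lemma card_sum_level_Suc:
  "card {F \<in> nsets {1..n} k. \<Sum>F = s} \<le> card {F \<in> nsets {2..Suc n} k. \<Sum>F = s + k}"
proof (rule card_inj_on_le[of "image Suc"])
  show "inj_on ((`) Suc) {F \<in> nsets {1..n} k. \<Sum>F = s}"
    by (rule inj_onI) (simp add: inj_image_eq_iff)
  show "(`) Suc ` {F \<in> nsets {1..n} k. \<Sum>F = s} \<subseteq> {F \<in> nsets {2..Suc n} k. \<Sum>F = s + k}"
    by (auto simp: nsets_def card_image sum.reindex sum_Suc)
qed (simp add: finite_imp_finite_nsets)

text \<open>Translation by one moves the level into \<open>{2..2 * k - 1}\<close>, and two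
  absorptions compare \<open>(2k - 2) choose k\<close> with \<open>(2k) choose k\<close>; the ratio
  tends to \<open>1 / 4\<close>.\<close>

lemma exists_large_sum_level_inner:
  assumes "k \<ge> 2"
  shows "\<exists>s. (real k - 1) / (3 * (2 * real k - 1) * (sqrt 2 * real k powr (3 / 2) + 1)) * real ((2 * k) choose k)
      \<le> real (card {F \<in> nsets {2..2 * k - 1} k. \<Sum>F = s})"
proof -
  define t where "t = sqrt 2 * real k powr (3 / 2) + 1"
  have t: "t > 0" by (simp add: t_def add_nonneg_pos)
  obtain s where s: "2 / 3 * real ((2 * k - 2) choose k) \<le> t * real (card {F \<in> nsets {1..2 * k - 2} k. \<Sum>F = s})"
    using exists_large_sum_level[OF assms] by (auto simp: t_def)
  also have "\<dots> \<le> t * real (card {F \<in> nsets {2..2 * k - 1} k. \<Sum>F = s + k})"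
  proof -
    have "Suc (2 * k - 2) = 2 * k - 1" using assms by simp
    then show ?thesis using card_sum_level_Suc[of "2 * k - 2" k s] t by (intro mult_left_mono) auto
  qed
  finally have *: "2 / 3 * real ((2 * k - 2) choose k) / t \<le> real (card {F \<in> nsets {2..2 * k - 1} k. \<Sum>F = s + k})"
    using t by (simp add: pos_divide_le_eq mult.commute)
  have "real ((2 * k - 2) choose k) = (real k - 1) / (2 * (2 * real k - 1)) * real ((2 * k) choose k)"
  proof -
    have "(2 * k - k) * ((2 * k) choose k) = 2 * k * ((2 * k - 1) choose k)"
      by (rule binomial_absorb_comp)
    then have a: "(2 * k) choose k = 2 * ((2 * k - 1) choose k)" using assms by simp
    have "(2 * k - 1 - k) * ((2 * k - 1) choose k) = (2 * k - 1) * ((2 * k - 1 - 1) choose k)"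
      by (rule binomial_absorb_comp)
    then have "(k - 1) * ((2 * k - 1) choose k) = (2 * k - 1) * ((2 * k - 2) choose k)"
      using assms by (simp add: numeral_2_eq_2)
    then have "real (k - 1) * real ((2 * k - 1) choose k) = real (2 * k - 1) * real ((2 * k - 2) choose k)"
      by (metis of_nat_mult)
    then show ?thesis using assms a by (simp add: of_nat_diff field_simps)
  qed
  moreover have "2 / 3 * (a / (2 * d) * N) / t = a / (3 * d * t) * N" for a d N :: real
    by simp
  ultimately have "2 / 3 * real ((2 * k - 2) choose k) / t
      = (real k - 1) / (3 * (2 * real k - 1) * t) * real ((2 * k) choose k)"
    by (simp only:)
  with * show ?thesis unfolding t_def by auto
qed

section \<open>The size of a level\<close>

definition lowerable :: "nat \<Rightarrow> nat set \<Rightarrow> nat set" where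
  "lowerable n F = {y \<in> {1..<n}. can_lower y F}"

lemma finite_lowerable [simp]: "finite (lowerable n F)"
  by (simp add: lowerable_def)

text \<open>Adjacent swaps match the ways of raising the sets of sum less than \<open>m\<close> with the ways of
  lowering the sets of sum at most \<open>m\<close>, so only the level \<open>m\<close> survives in the difference.\<close>

lemma sum_weights_lower_level:
  "(\<Sum>F | F \<in> nsets {1..n} k \<and> \<Sum>F = m. \<Sum>y\<in>lowerable n F. real y * (real n - real y))
   = (\<Sum>F | F \<in> nsets {1..n} k \<and> \<Sum>F < m. \<Sum>x\<in>F. real n + 1 - 2 * real x)"
proof -
  let ?P = "nsets {1..n} k" and ?I = "{1..<n}"
  define c where "c y = real y * (real n - real y)" for y
  define R where "R y = (\<Sum>F | F \<in> ?P \<and> \<Sum>F < m. of_bool (can_raise y F) :: real)" for y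
  define L where "L y A = (\<Sum>F | F \<in> ?P \<and> \<Sum>F \<in> A. of_bool (can_lower y F) :: real)" for y A
  have finP: "finite ?P" by (simp add: finite_imp_finite_nsets)
  have R: "R y = L y {..m}" if y: "y \<in> ?I" for y
  proof -
    have "R y = (\<Sum>F | F \<in> ?P \<and> \<Sum>F < m \<and> can_raise y F. 1)"
      unfolding R_def using finP by (intro sum.mono_neutral_cong_right) auto
    also have "\<dots> = (\<Sum>F | F \<in> ?P \<and> \<Sum>F \<le> m \<and> can_lower y F. 1)"
    proof (rule sum.reindex_bij_witness[of _ "swap_adj y" "swap_adj y"])
      fix F assume F: "F \<in> {F \<in> ?P. \<Sum>F < m \<and> can_raise y F}"
      then have "\<Sum>(swap_adj y F) = Suc (\<Sum>F)" by (intro sum_swap_adj) (auto simp: nsets_def)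
      then show "swap_adj y F \<in> {F \<in> ?P. \<Sum>F \<le> m \<and> can_lower y F}"
        using F swap_adj_nsets[OF _ y] by auto
    next
      fix F assume F: "F \<in> {F \<in> ?P. \<Sum>F \<le> m \<and> can_lower y F}"
      then have G: "swap_adj y F \<in> ?P" using swap_adj_nsets[OF _ y] by auto
      then have "\<Sum>(swap_adj y (swap_adj y F)) = Suc (\<Sum>(swap_adj y F))"
        using F by (intro sum_swap_adj) (auto simp: nsets_def)
      then show "swap_adj y F \<in> {F \<in> ?P. \<Sum>F < m \<and> can_raise y F}"
        using F G by auto
    qed auto
    also have "\<dots> = L y {..m}"
      unfolding L_def using finP by (intro sum.mono_neutral_cong_left) auto
    finally show ?thesis .
  qed
  have Lsplit: "L y {..m} = L y {..<m} + L y {m}" for y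
  proof -
    have "{F \<in> ?P. \<Sum>F \<in> {..m}} = {F \<in> ?P. \<Sum>F \<in> {..<m}} \<union> {F \<in> ?P. \<Sum>F \<in> {m}}" by auto
    then show ?thesis
      unfolding L_def using finP by (simp only:) (subst sum.union_disjoint, auto)
  qed
  have "(\<Sum>F | F \<in> ?P \<and> \<Sum>F < m. \<Sum>x\<in>F. real n + 1 - 2 * real x)
      = (\<Sum>F | F \<in> ?P \<and> \<Sum>F < m. \<Sum>y\<in>?I. c y * (of_bool (can_raise y F) - of_bool (can_lower y F)))"
    unfolding c_def by (intro sum.cong refl sum_weights_raise_minus_lower[symmetric]) (auto simp: nsets_def)
  also have "\<dots> = (\<Sum>y\<in>?I. c y * (R y - L y {..<m}))"
    by (subst sum.swap) (simp add: R_def L_def sum_subtractf right_diff_distrib sum_distrib_left)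
  also have "\<dots> = (\<Sum>y\<in>?I. c y * L y {m})"
    by (intro sum.cong refl) (simp add: R Lsplit)
  also have "\<dots> = (\<Sum>F | F \<in> ?P \<and> \<Sum>F = m. \<Sum>y\<in>?I. c y * of_bool (can_lower y F))"
    unfolding L_def sum_distrib_left by (subst sum.swap) simp
  also have "\<dots> = (\<Sum>F | F \<in> ?P \<and> \<Sum>F = m. \<Sum>y\<in>lowerable n F. c y)"
    by (intro sum.cong refl sum.mono_neutral_cong_right) (auto simp: lowerable_def)
  finally show ?thesis by (simp add: c_def)
qed

text \<open>A partial sum of \<open>h\<close> is at most the sum of its positive parts, which is
  half of the sum of \<open>\<bar>h F\<bar>\<close> since \<open>h\<close> has total zero.
  Cauchy-Schwarz and the variance bound the latter.\<close>

lemma sum_weights_lower_level_le: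
  assumes "k > 0" "n \<ge> 2" "k \<le> n"
  shows "(\<Sum>F | F \<in> nsets {1..n} k \<and> \<Sum>F = m. \<Sum>y\<in>lowerable n F. real y * (real n - real y))
     \<le> real (n choose k) / 2 * sqrt (real k * (real n - real k) * (real n + 1) / 3)"
proof -
  let ?P = "nsets {1..n} k"
  define h where "h F = (\<Sum>x\<in>F. real n + 1 - 2 * real x)" for F :: "nat set"
  define V where "V = real k * (real n - real k) * (real n + 1) / 3"
  have V: "V \<ge> 0" using assms by (simp add: V_def)
  have finP: "finite ?P" by (simp add: finite_imp_finite_nsets)
  \<comment> \<open>The total of \<open>h\<close> is obtained from
    \<open>sum_weights_lower_level\<close> at a level beyond every possible sum, where the left-hand
    side is empty.\<close>
  have "(\<Sum>F\<in>?P. h F) = (\<Sum>F | F \<in> ?P \<and> \<Sum>F < Suc (\<Sum>{1..n}). h F)"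
  proof (rule sum.cong)
    have "\<Sum>F \<le> \<Sum>{1..n}" if "F \<in> ?P" for F
      using that by (intro sum_mono2) (auto simp: nsets_def)
    then show "?P = {F \<in> ?P. \<Sum>F < Suc (\<Sum>{1..n})}" by (auto simp: less_Suc_eq_le)
  qed simp
  also have "\<dots> = (\<Sum>F | F \<in> ?P \<and> \<Sum>F = Suc (\<Sum>{1..n}). \<Sum>y\<in>lowerable n F. real y * (real n - real y))"
    unfolding h_def by (rule sum_weights_lower_level[symmetric])
  also have "\<dots> = 0"
  proof -
    have "\<Sum>F \<le> \<Sum>{1..n}" if "F \<in> ?P" for F
      using that by (intro sum_mono2) (auto simp: nsets_def)
    then have "{F \<in> ?P. \<Sum>F = Suc (\<Sum>{1..n})} = {}" by fastforce
    then show ?thesis by (simp only: sum.empty)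
  qed
  finally have h0: "(\<Sum>F\<in>?P. h F) = 0" .
  have "(\<Sum>F | F \<in> ?P \<and> \<Sum>F = m. \<Sum>y\<in>lowerable n F. real y * (real n - real y))
      = (\<Sum>F | F \<in> ?P \<and> \<Sum>F < m. h F)"
    unfolding h_def by (rule sum_weights_lower_level)
  also have "\<dots> \<le> (\<Sum>F | F \<in> ?P \<and> \<Sum>F < m. (\<bar>h F\<bar> + h F) / 2)"
    by (intro sum_mono) auto
  also have "\<dots> \<le> (\<Sum>F\<in>?P. (\<bar>h F\<bar> + h F) / 2)"
    using finP by (intro sum_mono2) auto
  also have "\<dots> = (\<Sum>F\<in>?P. \<bar>h F\<bar>) / 2"
    using h0 by (simp add: sum.distrib flip: sum_divide_distrib)
  also have "(\<Sum>F\<in>?P. \<bar>h F\<bar>) \<le> real (n choose k) * sqrt V"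
  proof -
    have "(\<Sum>F\<in>?P. \<bar>h F\<bar>)\<^sup>2 \<le> (\<Sum>F\<in>?P. \<bar>h F\<bar>\<^sup>2) * real (card ?P)"
      by (rule sum_squared_le_sum_of_squares)
    also have "\<dots> = (real (n choose k))\<^sup>2 * V"
      using sum_deviation_square[OF assms(1,2)]
      by (simp add: card_nsets h_def V_def power2_eq_square)
    finally have "(\<Sum>F\<in>?P. \<bar>h F\<bar>)\<^sup>2 \<le> (real (n choose k) * sqrt V)\<^sup>2"
      using V by (simp add: power_mult_distrib)
    then show ?thesis by (rule power2_le_imp_le) (use V in simp)
  qed
  finally show ?thesis by (simp add: V_def)
qed

subsection \<open>Sets which can be lowered in many places\<close>

text \<open>Without consecutive elements, the \<open>t\<close>-th smallest element is at least
  \<open>2 * t - 1\<close>, and the first odd numbers add up to a square.\<close>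

lemma card_square_le_sum:
  fixes Y :: "nat set"
  assumes "finite Y" "0 \<notin> Y" "\<And>y. y \<in> Y \<Longrightarrow> Suc y \<notin> Y"
  shows "(card Y)\<^sup>2 \<le> \<Sum>Y"
  using assms
proof (induction "card Y" arbitrary: Y)
  case (Suc n)
  define M where "M = Max Y"
  have Y: "Y \<noteq> {}" using Suc by auto
  then have M: "M \<in> Y" using Suc by (simp add: M_def)
  \<comment> \<open>\<open>Y\<close> and its shift by one are disjoint, so both fit below
    \<open>Suc M\<close> only if \<open>2 * card Y \<le> Suc M\<close>.\<close>
  have "Y \<union> Suc ` Y \<subseteq> {1..Suc M}"
  proof -
    have "y \<le> M \<and> y \<noteq> 0" if "y \<in> Y" for y using Suc.prems that unfolding M_def by (metis Max_ge)
    then show ?thesis by fastforce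
  qed
  then have "card (Y \<union> Suc ` Y) \<le> Suc M" using card_mono[of "{1..Suc M}"] by fastforce
  moreover have "card (Y \<union> Suc ` Y) = card Y + card Y"
    using Suc.prems by (subst card_Un_disjoint) (auto simp: card_image)
  ultimately have M1: "2 * card Y \<le> Suc M" by simp
  have "n = card (Y - {M})" using Suc.hyps M Suc.prems by simp
  then have "n\<^sup>2 \<le> \<Sum>(Y - {M})"
    using Suc.hyps(1)[of "Y - {M}"] Suc.prems by simp
  moreover have "\<Sum>Y = M + \<Sum>(Y - {M})" using M Suc.prems by (simp add: sum.remove)
  moreover have "(card Y)\<^sup>2 = n\<^sup>2 + 2 * n + 1"
    using Suc.hyps(2) by (simp add: power2_eq_square flip: Suc.hyps(2))
  ultimately show ?case using M1 Suc.hyps(2) by linarith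
qed simp

text \<open>No two lowerable positions are consecutive. The weight \<open>y (2k - y)\<close> is at
  least \<open>k\<close> times the distance of \<open>y\<close> to the nearer end, so
  \<open>card_square_le_sum\<close> applies to the lower half and to the reflected upper half;
  finally \<open>a^2 + b^2\<close> is at least half of \<open>(a + b)^2\<close>.\<close>

lemma sum_weights_lowerable_ge:
  "real k * (real (card (lowerable (2 * k) F)))\<^sup>2 / 2 \<le> (\<Sum>y\<in>lowerable (2 * k) F. real y * (real (2 * k) - real y))"
proof -
  define Y where "Y = lowerable (2 * k) F"
  define A where "A = Y \<inter> {..k}"
  define B where "B = Y \<inter> {k<..}"
  define B' where "B' = (\<lambda>y. 2 * k - y) ` B"
  have Y: "Y \<subseteq> {1..<2 * k}" "\<And>y. y \<in> Y \<Longrightarrow> Suc y \<notin> Y" "finite Y"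
    by (auto simp: Y_def lowerable_def can_lower_def)
  have inj: "inj_on (\<lambda>y. 2 * k - y) B"
    using Y(1) by (intro inj_onI) (auto simp: B_def subset_iff)
  have "(card A)\<^sup>2 \<le> \<Sum>A"
    using Y by (intro card_square_le_sum) (auto simp: A_def)
  from of_nat_mono[OF this, where 'a = real] have A: "(real (card A))\<^sup>2 \<le> (\<Sum>y\<in>A. real y)"
    by simp
  have "(card B')\<^sup>2 \<le> \<Sum>B'"
  proof (rule card_square_le_sum)
    show "0 \<notin> B'" using Y(1) by (auto simp: B'_def B_def)
    fix y assume "y \<in> B'"
    then obtain x where x: "x \<in> B" "y = 2 * k - x" by (auto simp: B'_def)
    show "Suc y \<notin> B'"
    proof
      assume "Suc y \<in> B'"
      then obtain z where z: "z \<in> B" "Suc y = 2 * k - z" by (auto simp: B'_def)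
      then have "x = Suc z" using x Y(1) by (auto simp: B_def subset_iff)
      then show False using x z Y(2) by (auto simp: B_def)
    qed
  qed (use Y in \<open>simp add: B'_def B_def\<close>)
  moreover have "card B' = card B" "\<Sum>B' = (\<Sum>y\<in>B. 2 * k - y)"
    using inj by (simp_all add: B'_def card_image sum.reindex)
  ultimately have "(card B)\<^sup>2 \<le> (\<Sum>y\<in>B. 2 * k - y)" by simp
  from of_nat_mono[OF this, where 'a = real]
  have "(real (card B))\<^sup>2 \<le> (\<Sum>y\<in>B. real (2 * k - y))"
    by (simp only: of_nat_power of_nat_sum)
  also have "\<dots> = (\<Sum>y\<in>B. real (2 * k) - real y)"
    using Y(1) by (intro sum.cong refl of_nat_diff) (auto simp: B_def subset_iff)
  finally have B: "(real (card B))\<^sup>2 \<le> (\<Sum>y\<in>B. real (2 * k) - real y)" .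
  have Yeq: "Y = A \<union> B" and AB: "finite A" "finite B" "A \<inter> B = {}"
    using Y(3) by (auto simp: A_def B_def)
  have YAB: "card Y = card A + card B" "\<And>f. sum f Y = sum f A + (sum f B :: real)"
    unfolding Yeq using AB by (rule card_Un_disjoint, rule sum.union_disjoint)
  have "(real (card Y))\<^sup>2 / 2 \<le> (real (card A))\<^sup>2 + (real (card B))\<^sup>2"
    using sum_squares_ge_zero[of "real (card A) - real (card B)" 0]
    by (simp add: YAB power2_eq_square algebra_simps)
  then have "real k * ((real (card Y))\<^sup>2 / 2) \<le> real k * ((real (card A))\<^sup>2 + (real (card B))\<^sup>2)"
    by (rule mult_left_mono) simp
  also have "\<dots> \<le> real k * ((\<Sum>y\<in>A. real y) + (\<Sum>y\<in>B. real (2 * k) - real y))"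
    using A B by (intro mult_left_mono add_mono) auto
  also have "\<dots> = (\<Sum>y\<in>A. real y * real k) + (\<Sum>y\<in>B. real k * (real (2 * k) - real y))"
    by (simp add: distrib_left sum_distrib_left mult.commute)
  also have "\<dots> \<le> (\<Sum>y\<in>A. real y * (real (2 * k) - real y)) + (\<Sum>y\<in>B. real y * (real (2 * k) - real y))"
    using Y(1) by (intro add_mono sum_mono mult_left_mono mult_right_mono) (auto simp: A_def B_def subset_iff)
  finally show ?thesis by (simp add: YAB Y_def[symmetric])
qed

text \<open>The factor at the last position is an eigenvector of the transfer matrix with eigenvalue
  \<open>1 + u\<close>: either way of deciding about \<open>n\<close>, the two extensions to
  \<open>Suc n\<close> contribute \<open>1 + u\<close> times the old term.\<close>

lemma generating_function_lowerable:
  fixes u :: real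
  assumes "n > 0"
  shows "(\<Sum>F\<in>Pow {1..n}. u ^ (2 * card (lowerable n F)) * (if n \<in> F then 1 else u)) = (1 + u) ^ n"
  using assms
proof (induction n rule: nat_induct_non_zero)
  case 1
  have "Pow {1..1::nat} = {{}, {1}}" by auto
  then show ?case by (simp add: lowerable_def)
next
  case (Suc n)
  have same: "lowerable (Suc n) F = lowerable n F" if "F \<subseteq> {1..n}" for F
    using that by (auto simp: lowerable_def can_lower_def less_Suc_eq)
  have ins: "card (lowerable (Suc n) (insert (Suc n) F)) = card (lowerable n F) + (if n \<in> F then 0 else 1)"
    if "F \<subseteq> {1..n}" for F
  proof -
    have "lowerable (Suc n) (insert (Suc n) F) = lowerable n F \<union> (if n \<in> F then {} else {n})"
      using that Suc.hyps by (auto simp: lowerable_def can_lower_def less_Suc_eq)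
    moreover have "n \<notin> lowerable n F" by (simp add: lowerable_def)
    ultimately show ?thesis by simp
  qed
  have Pow: "Pow {1..Suc n} = Pow {1..n} \<union> insert (Suc n) ` Pow {1..n}"
    by (simp add: atLeastAtMostSuc_conv Pow_insert)
  have disj: "Pow {1..n} \<inter> insert (Suc n) ` Pow {1..n} = {}" by auto
  have inj: "inj_on (insert (Suc n)) (Pow {1..n})"
  proof (rule inj_onI)
    fix F G assume "F \<in> Pow {1..n}" "G \<in> Pow {1..n}" "insert (Suc n) F = insert (Suc n) G"
    moreover from this have "Suc n \<notin> F" "Suc n \<notin> G" by auto
    ultimately show "F = G" by (metis insert_ident)
  qed
  define \<phi> where "\<phi> F = u ^ (2 * card (lowerable (Suc n) F)) * (if Suc n \<in> F then 1 else u)" for F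
  have "(\<Sum>F\<in>Pow {1..Suc n}. \<phi> F) = (\<Sum>F\<in>Pow {1..n}. \<phi> F) + (\<Sum>F\<in>Pow {1..n}. \<phi> (insert (Suc n) F))"
    unfolding Pow using disj inj by (subst sum.union_disjoint) (auto simp: sum.reindex)
  also have "\<dots> = (\<Sum>F\<in>Pow {1..n}. (1 + u) * (u ^ (2 * card (lowerable n F)) * (if n \<in> F then 1 else u)))"
    unfolding sum.distrib[symmetric]
  proof (rule sum.cong[OF refl])
    fix F assume "F \<in> Pow {1..n}"
    then have F: "F \<subseteq> {1..n}" and "Suc n \<notin> F" by auto
    then show "\<phi> F + \<phi> (insert (Suc n) F) = (1 + u) * (u ^ (2 * card (lowerable n F)) * (if n \<in> F then 1 else u))"
      unfolding \<phi>_def by (simp add: same[OF F] ins[OF F] power_add algebra_simps power2_eq_square)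
  qed
  also have "\<dots> = (1 + u) ^ Suc n"
    using Suc.IH by (simp flip: sum_distrib_left)
  finally show ?case by (simp only: \<phi>_def)
qed

text \<open>An exponential Markov bound from the generating function: about \<open>k / 2\<close>
  places are typical, fewer than \<open>3 * k / 7\<close> are exponentially rare.\<close>

lemma card_few_lowerable_le:
  assumes "k > 0"
  shows "real (card {F \<in> nsets {1..2 * k} k. 7 * card (lowerable (2 * k) F) < 3 * k})
    \<le> 8 / 3 * real k * (49 / 50) ^ k * real ((2 * k) choose k)"
proof -
  \<comment> \<open>The value minimising \<open>(1 + u)^2 / u powr (6 / 7)\<close>.\<close>
  define u :: real where "u = 3 / 4"
  define Bad where "Bad = {F \<in> nsets {1..2 * k} k. 7 * card (lowerable (2 * k) F) < 3 * k}"
  have u: "0 < u" "u < 1" by (auto simp: u_def)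
  have "real (card Bad) * (u powr (6 / 7 * real k) * u) = (\<Sum>F\<in>Bad. u powr (6 / 7 * real k) * u)"
    by simp
  also have "\<dots> \<le> (\<Sum>F\<in>Bad. u ^ (2 * card (lowerable (2 * k) F)) * (if 2 * k \<in> F then 1 else u))"
  proof (rule sum_mono)
    fix F assume "F \<in> Bad"
    then have "real (7 * card (lowerable (2 * k) F)) \<le> real (3 * k)"
      by (simp add: Bad_def)
    then have "real (2 * card (lowerable (2 * k) F)) \<le> 6 / 7 * real k"
      by simp
    then have "u powr (6 / 7 * real k) \<le> u powr real (2 * card (lowerable (2 * k) F))"
      using u by (intro powr_mono') auto
    then have "u powr (6 / 7 * real k) \<le> u ^ (2 * card (lowerable (2 * k) F))"
      using u by (simp only: powr_realpow)
    then show "u powr (6 / 7 * real k) * u \<le> u ^ (2 * card (lowerable (2 * k) F)) * (if 2 * k \<in> F then 1 else u)"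
      using u by (intro mult_mono) auto
  qed
  also have "\<dots> \<le> (\<Sum>F\<in>Pow {1..2 * k}. u ^ (2 * card (lowerable (2 * k) F)) * (if 2 * k \<in> F then 1 else u))"
    using u by (intro sum_mono2) (auto simp: Bad_def nsets_def)
  also have "\<dots> = (1 + u) ^ (2 * k)"
    using assms by (intro generating_function_lowerable) simp
  also have "\<dots> = ((1 + u)\<^sup>2) ^ k" by (rule power_mult)
  finally have "real (card Bad) * (u powr (6 / 7 * real k) * u) \<le> ((1 + u)\<^sup>2) ^ k" .
  then have "real (card Bad) * (u powr (6 / 7 * real k) * u) / (u powr (6 / 7 * real k) * u)
      \<le> ((1 + u)\<^sup>2) ^ k / (u powr (6 / 7 * real k) * u)"
    using u by (intro divide_right_mono) auto
  then have "real (card Bad) \<le> ((1 + u)\<^sup>2) ^ k / (u powr (6 / 7 * real k) * u)"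
    using u by simp
  also have "u powr (6 / 7 * real k) = (u powr (6 / 7)) powr real k"
    by (rule powr_powr[symmetric])
  also have "\<dots> = (u powr (6 / 7)) ^ k"
    using u by (simp only: powr_realpow powr_gt_zero)
  also have "((1 + u)\<^sup>2) ^ k / ((u powr (6 / 7)) ^ k * u) = 4 / 3 * ((1 + u)\<^sup>2 / u powr (6 / 7)) ^ k"
    by (simp add: u_def power_divide)
  also have "\<dots> \<le> 4 / 3 * (98 / 25) ^ k"
  proof -
    \<comment> \<open>A rational bound, verified on seventh powers.\<close>
    have "25 / 32 \<le> u powr (6 / 7)"
    proof -
      have "(u powr (6 / 7)) ^ 7 = (u powr (6 / 7)) powr real 7"
        by (rule powr_realpow[symmetric]) (use u in simp)
      also have "\<dots> = u powr real 6" by (simp add: powr_powr)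
      also have "\<dots> = u ^ 6" by (rule powr_realpow) (use u in simp)
      finally have "(25 / 32) ^ 7 \<le> (u powr (6 / 7)) ^ 7" by (simp add: u_def power_divide)
      then show ?thesis by (subst (asm) power_mono_iff) auto
    qed
    then have "(1 + u)\<^sup>2 / u powr (6 / 7) \<le> 98 / 25"
      using u by (simp add: pos_divide_le_eq u_def power2_eq_square)
    then show ?thesis using u by (intro mult_left_mono power_mono) auto
  qed
  \<comment> \<open>Since \<open>98 / 25 = 4 * (49 / 50)\<close>, the power of 4 can be traded for
    the central binomial coefficient, which is at least \<open>4 ^ k / (2 * k)\<close>.\<close>
  also have "\<dots> = 8 / 3 * real k * (49 / 50) ^ k * (4 ^ k / (2 * real k))"
  proof -
    have "(98 / 25 :: real) ^ k = (49 / 50) ^ k * 4 ^ k" by (simp flip: power_mult_distrib)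
    then show ?thesis using assms by simp
  qed
  also have "\<dots> \<le> 8 / 3 * real k * (49 / 50) ^ k * real ((2 * k) choose k)"
    using central_binomial_lower_bound[OF assms] by (intro mult_left_mono) auto
  finally show ?thesis by (simp add: Bad_def)
qed

text \<open>Sets with few lowerable places are negligible; each other member of the level has weight
  at least \<open>k (3k / 7)^2 / 2 = 9 k^3 / 98\<close>, while the total weight of the level is
  bounded by \<open>sum_weights_lower_level_le\<close>.\<close>

lemma card_sum_level_le:
  assumes "k > 0"
  shows "real (card {F \<in> nsets {1..2 * k} k. \<Sum>F = m})
    \<le> (8 / 3 * real k * (49 / 50) ^ k + 49 / (9 * (real k)\<^sup>2) * sqrt ((2 * real k + 1) / 3)) * real ((2 * k) choose k)"
proof -
  let ?P = "nsets {1..2 * k} k" and ?t = "\<lambda>F. card (lowerable (2 * k) F)"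
  define N where "N = real ((2 * k) choose k)"
  define Bad where "Bad = {F \<in> ?P. 7 * ?t F < 3 * k}"
  define Good where "Good = {F \<in> ?P. \<Sum>F = m \<and> \<not> 7 * ?t F < 3 * k}"
  have finP: "finite ?P" by (simp add: finite_imp_finite_nsets)
  have "card {F \<in> ?P. \<Sum>F = m} \<le> card (Bad \<union> Good)"
    using finP by (intro card_mono) (auto simp: Bad_def Good_def)
  also have "\<dots> \<le> card Bad + card Good" by (rule card_Un_le)
  finally have "real (card {F \<in> ?P. \<Sum>F = m}) \<le> real (card Bad) + real (card Good)" by linarith
  moreover have "real (card Bad) \<le> 8 / 3 * real k * (49 / 50) ^ k * N"
    unfolding Bad_def N_def by (rule card_few_lowerable_le[OF assms])
  moreover have "real (card Good) \<le> 49 / (9 * (real k)\<^sup>2) * sqrt ((2 * real k + 1) / 3) * N"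
  proof -
    have pos: "0 \<le> (\<Sum>y\<in>lowerable (2 * k) F. real y * (real (2 * k) - real y))" for F
      by (rule order_trans[OF _ sum_weights_lowerable_ge]) simp
    have "real (card Good) * (9 / 98 * real k ^ 3) = (\<Sum>F\<in>Good. 9 / 98 * real k ^ 3)" by simp
    also have "\<dots> \<le> (\<Sum>F\<in>Good. \<Sum>y\<in>lowerable (2 * k) F. real y * (real (2 * k) - real y))"
    proof (rule sum_mono)
      fix F assume "F \<in> Good"
      then have "real (3 * k) \<le> real (7 * ?t F)" by (simp add: Good_def)
      then have "3 / 7 * real k \<le> real (?t F)" by simp
      then have "(3 / 7 * real k)\<^sup>2 \<le> (real (?t F))\<^sup>2" by (intro power_mono) auto
      then have "real k * (3 / 7 * real k)\<^sup>2 \<le> real k * (real (?t F))\<^sup>2" by (intro mult_left_mono) auto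
      then have "9 / 98 * real k ^ 3 \<le> real k * (real (?t F))\<^sup>2 / 2"
        by (simp add: power2_eq_square power3_eq_cube)
      also have "\<dots> \<le> (\<Sum>y\<in>lowerable (2 * k) F. real y * (real (2 * k) - real y))"
        by (rule sum_weights_lowerable_ge)
      finally show "9 / 98 * real k ^ 3 \<le> (\<Sum>y\<in>lowerable (2 * k) F. real y * (real (2 * k) - real y))" .
    qed
    also have "\<dots> \<le> (\<Sum>F | F \<in> ?P \<and> \<Sum>F = m. \<Sum>y\<in>lowerable (2 * k) F. real y * (real (2 * k) - real y))"
      using finP pos by (intro sum_mono2) (auto simp: Good_def)
    also have "\<dots> \<le> N / 2 * sqrt (real k * (real (2 * k) - real k) * (real (2 * k) + 1) / 3)"
      unfolding N_def using assms by (intro sum_weights_lower_level_le) auto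
    also have "real k * (real (2 * k) - real k) * (real (2 * k) + 1) / 3 = (real k)\<^sup>2 * ((2 * real k + 1) / 3)"
      by (simp add: power2_eq_square)
    also have "sqrt \<dots> = real k * sqrt ((2 * real k + 1) / 3)"
      by (simp only: real_sqrt_mult real_sqrt_abs abs_of_nat)
    finally have "real (card Good) * (9 / 98 * real k ^ 3) / (9 / 98 * real k ^ 3)
        \<le> N / 2 * (real k * sqrt ((2 * real k + 1) / 3)) / (9 / 98 * real k ^ 3)"
      using assms by (intro divide_right_mono) auto
    then have "real (card Good) \<le> N / 2 * (real k * sqrt ((2 * real k + 1) / 3)) / (9 / 98 * real k ^ 3)"
      using assms by simp
    also have "\<dots> = 49 / (9 * (real k)\<^sup>2) * sqrt ((2 * real k + 1) / 3) * N"
      using assms by (simp add: power2_eq_square power3_eq_cube)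
    finally show ?thesis .
  qed
  ultimately show ?thesis by (simp add: N_def distrib_right)
qed

section \<open>Counting maximal families\<close>

lemma sum_power_card_Pow:
  fixes x :: "'b :: comm_semiring_1"
  assumes "finite S"
  shows "(\<Sum>A\<in>Pow S. x ^ card A) = (1 + x) ^ card S"
  using prod_add[OF assms, of "\<lambda>_. x" "\<lambda>_. 1"] by (simp add: add.commute)

text \<open>As \<open>x \<le> 1\<close>, every counted set contributes at least \<open>x ^ w\<close>
  to the binomial sum over all subsets.\<close>

lemma card_small_subsets_le:
  fixes x :: real
  assumes "finite S" "0 < x" "x \<le> 1"
  shows "real (card {A. A \<subseteq> S \<and> card A \<le> w}) * x ^ w \<le> exp (x * real (card S))"
proof -
  have "real (card {A. A \<subseteq> S \<and> card A \<le> w}) * x ^ w = (\<Sum>A | A \<subseteq> S \<and> card A \<le> w. x ^ w)"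
    by simp
  also have "\<dots> \<le> (\<Sum>A | A \<subseteq> S \<and> card A \<le> w. x ^ card A)"
    using assms by (intro sum_mono power_decreasing) auto
  also have "\<dots> \<le> (\<Sum>A\<in>Pow S. x ^ card A)"
    using assms by (intro sum_mono2) auto
  also have "\<dots> = (1 + x) ^ card S" by (rule sum_power_card_Pow[OF assms(1)])
  also have "\<dots> \<le> exp x ^ card S"
    using assms by (intro power_mono) auto
  also have "\<dots> = exp (x * real (card S))" by (simp add: exp_of_nat2_mult)
  finally show ?thesis .
qed

text \<open>A left-compressed family is the down-set generated by its maximal members, which form an
  antichain.\<close>

lemma card_MLCIFs_le_antichains:
  "card (MLCIFs k) \<le> card {\<A>. \<A> \<subseteq> nsets {1..2 * k} k \<and> LC_antichain \<A>}"
proof (rule card_inj_on_le)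
  let ?P = "nsets {1..2 * k} k"
  define top where "top \<D> = {F \<in> \<D>. \<forall>G\<in>\<D>. F \<le>LC G \<longrightarrow> F = G}" for \<D> :: "nat set set"
  show "top ` MLCIFs k \<subseteq> {\<A>. \<A> \<subseteq> ?P \<and> LC_antichain \<A>}"
    by (auto simp: MLCIFs_def MLCIF_def left_compressed_intersecting_def top_def LC_antichain_def)
  have recover: "\<D> = {F \<in> ?P. \<exists>G\<in>top \<D>. F \<le>LC G}" if "\<D> \<in> MLCIFs k" for \<D>
  proof -
    have D: "\<D> \<subseteq> ?P" "left_compressed (2 * k) k \<D>"
      using that by (auto simp: MLCIFs_def MLCIF_def left_compressed_intersecting_def)
    have finD: "finite \<D>" by (rule finite_subset[OF D(1)]) (simp add: finite_imp_finite_nsets)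
    have fin: "finite F" if "F \<in> \<D>" for F using that D(1) by (auto simp: nsets_def)
    have "\<exists>G\<in>top \<D>. F \<le>LC G" if F: "F \<in> \<D>" for F
    proof -
      let ?U = "{G \<in> \<D>. F \<le>LC G}"
      have "finite (Sum ` ?U)" "Sum ` ?U \<noteq> {}" using finD F by auto
      \<comment> \<open>Among the members above \<open>F\<close>, one of largest sum is maximal,
        because the sum is strictly monotone.\<close>
      then obtain G where G: "G \<in> ?U" "\<Sum>G = Max (Sum ` ?U)"
        using Max_in[of "Sum ` ?U"] by (metis (no_types, lifting) imageE)
      have "G = H" if H: "H \<in> \<D>" "G \<le>LC H" for H
      proof -
        have "H \<in> ?U" using H G left_compression_trans by blast
        then have "\<Sum>H \<le> \<Sum>G" using G(2) finD by simp
        moreover have "\<Sum>G \<le> \<Sum>H" using H G fin by (intro left_compression_sum_le) auto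
        ultimately show "G = H" using H G fin by (intro left_compression_sum_eq) auto
      qed
      then show ?thesis using G by (auto simp: top_def)
    qed
    then show ?thesis using D by (auto simp: left_compressed_def top_def)
  qed
  show "inj_on top (MLCIFs k)"
    by (rule inj_onI) (metis recover)
  show "finite {\<A>. \<A> \<subseteq> ?P \<and> LC_antichain \<A>}"
    by (rule finite_subset[of _ "Pow ?P"]) (auto simp: finite_imp_finite_nsets)
qed

text \<open>Antichains are counted among all subfamilies no larger than the middle level. The
  parameter \<open>x\<close> stays free, to be balanced against \<open>w\<close> later.\<close>

lemma card_MLCIFs_le_exp:
  fixes x w :: real
  assumes "k > 0" "0 < x" "x \<le> 1"
    and w: "\<And>m. real (card {F \<in> nsets {1..2 * k} k. \<Sum>F = m}) \<le> w * real ((2 * k) choose k)"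
  shows "real (card (MLCIFs k)) \<le> exp ((x - w * ln x) * real ((2 * k) choose k))"
proof -
  let ?P = "nsets {1..2 * k} k" and ?N = "real ((2 * k) choose k)"
  define W where "W = card {F \<in> ?P. \<Sum>F = (k * (2 * k + 1) + 1) div 2}"
  have finP: "finite ?P" by (simp add: finite_imp_finite_nsets)
  have "card (MLCIFs k) \<le> card {\<A>. \<A> \<subseteq> ?P \<and> card \<A> \<le> W}"
    using card_MLCIFs_le_antichains[of k]
  proof (rule order_trans)
    show "card {\<A>. \<A> \<subseteq> ?P \<and> LC_antichain \<A>} \<le> card {\<A>. \<A> \<subseteq> ?P \<and> card \<A> \<le> W}"
      using finP card_antichain_le_middle_level[of _ k] unfolding W_def by (intro card_mono) auto
  qed
  then have "real (card (MLCIFs k)) * x ^ W \<le> real (card {\<A>. \<A> \<subseteq> ?P \<and> card \<A> \<le> W}) * x ^ W"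
    using assms by (intro mult_right_mono) auto
  also have "\<dots> \<le> exp (x * real (card ?P))"
    by (rule card_small_subsets_le[OF finP assms(2,3)])
  also have "real (card ?P) = ?N" by (simp add: card_nsets)
  finally have "real (card (MLCIFs k)) \<le> exp (x * ?N) / x ^ W"
    using assms by (simp add: pos_le_divide_eq)
  also have "x ^ W = exp (real W * ln x)"
    using assms by (simp add: exp_of_nat_mult)
  also have "exp (x * ?N) / exp (real W * ln x) = exp (x * ?N - real W * ln x)"
    by (simp add: exp_diff)
  also have "\<dots> \<le> exp ((x - w * ln x) * ?N)"
  proof -
    have "ln x \<le> 0" using assms by simp
    then have "w * ?N * ln x \<le> real W * ln x"
      using w[of "(k * (2 * k + 1) + 1) div 2"] by (intro mult_right_mono_neg) (auto simp: W_def)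
    then show ?thesis by (simp add: algebra_simps)
  qed
  finally show ?thesis .
qed

section \<open>The asymptotic bounds\<close>

lemma eventually_card_MLCIFs_gt:
  "\<forall>\<^sub>F k::nat in sequentially.
     2 powr (1 / 9 * real k powr (- 3 / 2) * real ((2 * k) choose k)) < real (card (MLCIFs k))"
proof -
  have "\<forall>\<^sub>F k::nat in sequentially.
      1 / 9 * real k powr (- 3 / 2) < (real k - 1) / (3 * (2 * real k - 1) * (71 / 50 * real k powr (3 / 2) + 1))"
    by real_asymp
  then show ?thesis
    using eventually_ge_at_top[of 2]
  proof eventually_elim
    case (elim k)
    obtain s where s: "(real k - 1) / (3 * (2 * real k - 1) * (sqrt 2 * real k powr (3 / 2) + 1)) * real ((2 * k) choose k)
      \<le> real (card {F \<in> nsets {2..2 * k - 1} k. \<Sum>F = s})"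
      using exists_large_sum_level_inner[OF elim(2)] by blast
    define B where "B = card {F \<in> nsets {2..2 * k - 1} k. \<Sum>F = s}"
    \<comment> \<open>The asymptotic comparison above uses this rational bound; its leading constant
      is \<open>1 / (6 * 71 / 50) = 1 / 8.52\<close>, still larger than
      \<open>1 / 9\<close>.\<close>
    have "sqrt 2 \<le> 71 / 50" by (rule real_le_lsqrt) (simp_all add: power2_eq_square)
    then have "(real k - 1) / (3 * (2 * real k - 1) * (71 / 50 * real k powr (3 / 2) + 1))
        \<le> (real k - 1) / (3 * (2 * real k - 1) * (sqrt 2 * real k powr (3 / 2) + 1))"
      using elim(2) by (intro divide_left_mono mult_left_mono add_mono mult_right_mono mult_pos_pos add_nonneg_pos) auto
    with elim(1) have "1 / 9 * real k powr (- 3 / 2) < (real k - 1) / (3 * (2 * real k - 1) * (sqrt 2 * real k powr (3 / 2) + 1))"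
      by linarith
    then have "1 / 9 * real k powr (- 3 / 2) * real ((2 * k) choose k)
      < (real k - 1) / (3 * (2 * real k - 1) * (sqrt 2 * real k powr (3 / 2) + 1)) * real ((2 * k) choose k)"
      by (intro mult_strict_right_mono) simp_all
    also have "\<dots> \<le> real B" using s by (simp add: B_def)
    finally have "2 powr (1 / 9 * real k powr (- 3 / 2) * real ((2 * k) choose k)) < 2 powr real B"
      by (intro powr_less_mono) auto
    also have "\<dots> = real (2 ^ B)" by (simp add: powr_realpow)
    also have "\<dots> \<le> real (card (MLCIFs k))"
      using two_power_sum_level_le[of k s] elim(2) unfolding B_def by (simp only: of_nat_le_iff)
    finally show ?case .
  qed
qed

text \<open>With \<open>x = k powr (- 3 / 2)\<close> the exponent is dominated by
  \<open>3 / 2 * w * ln k\<close>. Its leading constant is \<open>3 / 2 * 49 / 9 * 17 / 20\<close>,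
  about \<open>6.94\<close>, just below 7.\<close>

lemma eventually_card_MLCIFs_less:
  "\<forall>\<^sub>F k::nat in sequentially.
     real (card (MLCIFs k)) < 2 powr (7 * log 2 (real k) * real k powr (- 3 / 2) * real ((2 * k) choose k))"
proof -
  define w where "w k = 8 / 3 * real k * (49 / 50) ^ k + 49 / (9 * (real k)\<^sup>2) * (17 / 20 * sqrt (real k))" for k
  have "\<forall>\<^sub>F k::nat in sequentially.
      real k powr (- 3 / 2) + w k * (3 / 2 * ln (real k)) < 7 * ln (real k) * real k powr (- 3 / 2)"
    unfolding w_def by real_asymp
  then show ?thesis
    using eventually_ge_at_top[of 6]
  proof eventually_elim
    case (elim k)
    let ?N = "real ((2 * k) choose k)"
    define x where "x = real k powr (- 3 / 2)"
    have k: "k > 0" using elim(2) by simp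
    have x: "0 < x" "x \<le> 1" "ln x = - (3 / 2 * ln (real k))"
      using elim(2) by (auto simp: x_def ln_powr powr_mono[of "- 3 / 2" 0 "real k", simplified])
    \<comment> \<open>\<open>17 / 20\<close> is a rational number slightly above
      \<open>sqrt (2 / 3)\<close>; the inequality holds from \<open>k = 6\<close> on.\<close>
    have sq: "sqrt ((2 * real k + 1) / 3) \<le> 17 / 20 * sqrt (real k)"
    proof (rule real_le_lsqrt)
      show "(2 * real k + 1) / 3 \<le> (17 / 20 * sqrt (real k))\<^sup>2"
        using elim(2) by (simp add: power_mult_distrib power2_eq_square)
    qed simp_all
    have "real (card {F \<in> nsets {1..2 * k} k. \<Sum>F = m}) \<le> w k * ?N" for m
    proof (rule order_trans[OF card_sum_level_le[OF k]])
      have "8 / 3 * real k * (49 / 50) ^ k + 49 / (9 * (real k)\<^sup>2) * sqrt ((2 * real k + 1) / 3) \<le> w k"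
        unfolding w_def using sq by (intro add_left_mono mult_left_mono) auto
      then show "(8 / 3 * real k * (49 / 50) ^ k + 49 / (9 * (real k)\<^sup>2) * sqrt ((2 * real k + 1) / 3)) * ?N \<le> w k * ?N"
        by (rule mult_right_mono) simp
    qed
    then have "real (card (MLCIFs k)) \<le> exp ((x - w k * ln x) * ?N)"
      by (rule card_MLCIFs_le_exp[OF k x(1,2)])
    also have "\<dots> < exp (7 * ln (real k) * real k powr (- 3 / 2) * ?N)"
    proof -
      have "x - w k * ln x < 7 * ln (real k) * real k powr (- 3 / 2)"
        using elim(1) unfolding x(3) unfolding x_def by simp
      then show ?thesis by (simp add: zero_less_binomial)
    qed
    also have "\<dots> = 2 powr (7 * log 2 (real k) * real k powr (- 3 / 2) * ?N)"
      by (simp add: powr_def log_def)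
    finally show ?case .
  qed
qed

theorem theorem1p1:
  shows "(\<forall>k::nat. k \<ge> 2 \<longrightarrow>
            2 powr (1 / 2 * real ((k - 1) choose (k div 2))) \<le> real (card (MLCIFs k)) \<and>
            real (card (MLCIFs k)) \<le> 2 powr (1 / 2 * real ((2 * k) choose k))) \<and>
         (\<forall>\<^sub>F k::nat in sequentially.
            2 powr (1 / 9 * real k powr (- 3 / 2) * real ((2 * k) choose k)) < real (card (MLCIFs k)) \<and>
            real (card (MLCIFs k)) <
              2 powr (7 * log 2 (real k) * real k powr (- 3 / 2) * real ((2 * k) choose k)))"
  using card_MLCIFs_bounds eventually_conj[OF eventually_card_MLCIFs_gt eventually_card_MLCIFs_less]
  by blast

end
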